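(* Let $N\geq 2$, $1<p<N$, and let $\Omega\subset\mathbb{R}^N$ be a bounded and smooth domain. Let $p^\star:=\frac{Np}{N-p}$ and, for $1\leq q\leq p^\star$, let $$\lambda_q:=\inf\left\{\frac{\|\nabla u\|_{p}^p}{\|u\|_{q}^p}: u\in W_0^{1,p}(\Omega)\setminus\{0\}\right\}.$$ For each $\epsilon>0$, there exists a positive constant $\mathcal{L}_\epsilon$ such that $$\left||\Omega|^{\frac{p}{s}}\lambda_s-|\Omega|^{\frac{p}{q}}\lambda_q\right|\leq\mathcal{L}_\epsilon|s-q|$$ for all $s,q\in[1,p^\star-\epsilon]$.
   Context: $\|\cdot\|_s:=\left(\int_\Omega|\cdot|^s\,dx\right)^{1/s}$ denotes the usual norm of $L^s(\Omega)$, $|\Omega|$ denotes the $N$-dimensional Lebesgue volume of $\Omega$, and $W_0^{1,p}(\Omega)$ is the usual Sobolev space (closure of $C_c^\infty(\Omega)$ in $W^{1,p}(\Omega)$). *)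

theory Defs
  imports "HOL-Analysis.Analysis"
begin

section \<open>Smooth functions and smooth domains\<close>

primrec C_k :: "nat \<Rightarrow> ('a::euclidean_space \<Rightarrow> real) \<Rightarrow> bool" where
  "C_k 0 f \<longleftrightarrow> continuous_on UNIV f"
| "C_k (Suc k) f \<longleftrightarrow>
     (\<forall>x. f differentiable (at x)) \<and> (\<forall>v. C_k k (\<lambda>x. frechet_derivative f (at x) v))"

definition smooth_fun :: "('a::euclidean_space \<Rightarrow> real) \<Rightarrow> bool" where
  "smooth_fun f \<longleftrightarrow> (\<forall>k. C_k k f)"

text \<open>
  Near each boundary point, \<Omega> lies on one side of the graph of a smooth function over a
  hyperplane \<open>\<nu>\<^sup>\<bottom>\<close>. The function \<gamma> is evaluated on the orthogonal projection to that hyperplane,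
  so only its restriction to \<open>\<nu>\<^sup>\<bottom>\<close> (a copy of \<open>(N-1)\<close>-dimensional space) matters; the freedom
  in \<nu> replaces the usual rotation of the coordinate axes.
\<close>
definition smooth_boundary :: "'a::euclidean_space set \<Rightarrow> bool" where
  "smooth_boundary \<Omega> \<longleftrightarrow>
     (\<forall>x0 \<in> frontier \<Omega>. \<exists>r>0. \<exists>\<nu> \<gamma>. norm \<nu> = 1 \<and> smooth_fun \<gamma> \<and>
        \<Omega> \<inter> ball x0 r = {x \<in> ball x0 r. x \<bullet> \<nu> > \<gamma> (x - (x \<bullet> \<nu>) *\<^sub>R \<nu>)})"

definition smooth_domain :: "'a::euclidean_space set \<Rightarrow> bool" where
  "smooth_domain \<Omega> \<longleftrightarrow> open \<Omega> \<and> connected \<Omega> \<and> \<Omega> \<noteq> {} \<and> smooth_boundary \<Omega>"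

section \<open>Lebesgue and Sobolev spaces\<close>

text \<open>
  Elements of the function spaces are represented by total functions, of which only the values
  on \<Omega> matter; two functions represent the same element iff they agree almost everywhere in \<Omega>.
\<close>

definition Lp_space :: "real \<Rightarrow> 'a::euclidean_space set \<Rightarrow> ('a \<Rightarrow> 'b::euclidean_space) set" where
  "Lp_space s \<Omega> = {u \<in> borel_measurable (lebesgue_on \<Omega>).
     integrable (lebesgue_on \<Omega>) (\<lambda>x. norm (u x) powr s)}"

definition Lp_norm :: "real \<Rightarrow> 'a::euclidean_space set \<Rightarrow> ('a \<Rightarrow> 'b::euclidean_space) \<Rightarrow> real" where
  "Lp_norm s \<Omega> u = (LINT x|lebesgue_on \<Omega>. norm (u x) powr s) powr (1 / s)"

definition test_funs :: "'a::euclidean_space set \<Rightarrow> ('a \<Rightarrow> real) set" where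
  "test_funs \<Omega> = {\<phi>. smooth_fun \<phi> \<and> compact (closure {x. \<phi> x \<noteq> 0}) \<and> closure {x. \<phi> x \<noteq> 0} \<subseteq> \<Omega>}"

definition loc_integrable :: "'a::euclidean_space set \<Rightarrow> ('a \<Rightarrow> 'b::euclidean_space) \<Rightarrow> bool" where
  "loc_integrable \<Omega> u \<longleftrightarrow> (\<forall>K. compact K \<and> K \<subseteq> \<Omega> \<longrightarrow> integrable (lebesgue_on K) u)"

definition has_weak_gradient ::
    "'a::euclidean_space set \<Rightarrow> ('a \<Rightarrow> real) \<Rightarrow> ('a \<Rightarrow> 'a) \<Rightarrow> bool" where
  "has_weak_gradient \<Omega> u g \<longleftrightarrow>
     loc_integrable \<Omega> u \<and> loc_integrable \<Omega> g \<and>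
     (\<forall>\<phi>\<in>test_funs \<Omega>. \<forall>b\<in>Basis.
        (LINT x|lebesgue_on \<Omega>. u x * frechet_derivative \<phi> (at x) b)
          = - (LINT x|lebesgue_on \<Omega>. (g x \<bullet> b) * \<phi> x))"

text \<open>On an open set the weak gradient is unique up to null sets, so the choice does not affect norms.\<close>
definition weak_gradient :: "'a::euclidean_space set \<Rightarrow> ('a \<Rightarrow> real) \<Rightarrow> 'a \<Rightarrow> 'a" where
  "weak_gradient \<Omega> u = (SOME g. has_weak_gradient \<Omega> u g)"

definition W1p :: "real \<Rightarrow> 'a::euclidean_space set \<Rightarrow> ('a \<Rightarrow> real) set" where
  "W1p p \<Omega> = {u \<in> Lp_space p \<Omega>. \<exists>g \<in> Lp_space p \<Omega>. has_weak_gradient \<Omega> u g}"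

definition W1p_norm :: "real \<Rightarrow> 'a::euclidean_space set \<Rightarrow> ('a \<Rightarrow> real) \<Rightarrow> real" where
  "W1p_norm p \<Omega> u = (Lp_norm p \<Omega> u powr p + Lp_norm p \<Omega> (weak_gradient \<Omega> u) powr p) powr (1 / p)"

definition W1p_0 :: "real \<Rightarrow> 'a::euclidean_space set \<Rightarrow> ('a \<Rightarrow> real) set" where
  "W1p_0 p \<Omega> = {u \<in> W1p p \<Omega>. \<forall>\<epsilon>>0. \<exists>\<phi>\<in>test_funs \<Omega>. W1p_norm p \<Omega> (\<lambda>x. u x - \<phi> x) < \<epsilon>}"

section \<open>Critical exponent and best constants\<close>

definition sobolev_conj :: "nat \<Rightarrow> real \<Rightarrow> real" where
  "sobolev_conj N p = real N * p / (real N - p)"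

text \<open>
  The infimum is real-valued: for \<open>1 \<le> q \<le> sobolev_conj N p\<close> the Sobolev embedding makes the
  denominators finite and positive, and the set is nonempty and bounded below by 0.
\<close>
definition sobolev_lambda :: "real \<Rightarrow> 'a::euclidean_space set \<Rightarrow> real \<Rightarrow> real" where
  "sobolev_lambda p \<Omega> q =
     Inf {Lp_norm p \<Omega> (weak_gradient \<Omega> u) powr p / Lp_norm q \<Omega> u powr p | u.
            u \<in> W1p_0 p \<Omega> \<and> \<not> (AE x in lebesgue_on \<Omega>. u x = 0)}"

end

theory Submission
  imports Defs
begin

text \<open>
  Write \<open>V\<close> for the volume of \<open>\<Omega>\<close> and let \<open>M\<^sub>q(u)\<close> be the normalised mean
  \<open>(V\<^sup>-\<^sup>1 \<integral> |u|\<^sup>q)\<^sup>1\<^sup>/\<^sup>q\<close>. The quantity \<open>V powr (p / q) * \<lambda>\<^sub>q\<close> is the infimum over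
  \<open>u\<close> of \<open>\<rho>\<^sub>q(u) = E(u) / M\<^sub>q(u)\<^sup>p\<close>, where \<open>E(u)\<close> is the integral of \<open>|\<nabla>u|\<^sup>p\<close>. Means increase with
  their exponent, so these infima decrease in \<open>q\<close>, and only a bound on the rate of
  decrease is needed.

  Let \<open>q \<le> s\<close> and let \<open>r\<close> exceed all admissible exponents by at least \<open>\<epsilon>/2\<close> while staying
  below the critical one. The elementary inequality
  \<open>y\<^sup>s - y\<^sup>q \<le> (s - q) / (r - s) * y\<^sup>r\<close>, applied to \<open>y = |u| / M\<^sub>s(u)\<close> and integrated, shows that
  \<open>(M\<^sub>q(u) / M\<^sub>s(u))\<^sup>q\<close> is at least \<open>1 - (s - q) / (r - s) * (M\<^sub>r(u) / M\<^sub>s(u))\<^sup>r\<close> (\<open>power_integrals_compare\<close>). The embedding of \<open>W\<^sub>0\<^sup>1\<^sup>,\<^sup>p\<close> into \<open>L\<^sup>r\<close> bounds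
  \<open>M\<^sub>r(u) / M\<^sub>s(u)\<close> by a power of \<open>\<rho>\<^sub>s(u)\<close>, and along near-minimisers of \<open>\<rho>\<^sub>s\<close> this is bounded
  uniformly. Hence \<open>\<rho>\<^sub>q\<close> exceeds \<open>\<rho>\<^sub>s\<close> there by at most a constant times \<open>s - q\<close>, and so do the infima
  (\<open>infima_lipschitz\<close>).

  The embedding is proved first for test functions \<open>\<phi>\<close>. For \<open>x\<close> in \<open>\<Omega>\<close>, \<open>\<phi>(x)\<close> is minus the integral of
  the derivative of \<open>\<phi>\<close> along any ray leaving \<open>\<Omega>\<close>. Averaging over the rays with direction \<open>w\<close> in a
  fixed ball \<open>A\<close> away from the origin bounds \<open>|\<phi>(x)|\<close> by the integral over \<open>t\<close> of the averages of
  \<open>|\<nabla>\<phi>|\<close> over \<open>x + t A\<close>. Such an average maps \<open>L\<^sup>p\<close> to \<open>L\<^sup>r\<close> with norm of order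
  \<open>t powr (- N (1/p - 1/r))\<close> (\<open>scaled_average_gain\<close>), which is integrable at \<open>0\<close> exactly
  when \<open>r\<close> is below the critical exponent.

  Passing from test functions to \<open>W\<^sub>0\<^sup>1\<^sup>,\<^sup>p\<close> is Fatou's lemma, once weak gradients behave as expected: they
  are unique almost everywhere (\<open>fundamental_lemma\<close>, which needs smooth approximations of indicators
  of boxes), and the classical gradient of a test function is a weak gradient
  (\<open>has_weak_gradient_grad\<close>).
\<close>

section \<open>Smooth functions and cutoffs of boxes\<close>

lemma C_k_continuous: "C_k k f \<Longrightarrow> continuous_on UNIV f"
  by (cases k) (auto intro!: differentiable_imp_continuous_on simp: differentiable_on_def
      intro: differentiable_at_withinI)

text \<open>
  Derivatives are unique, so one computed by rules can stand in for \<open>frechet_derivative\<close>.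
\<close>
lemma C_k_SucI:
  assumes "\<And>x. (f has_derivative D x) (at x)" and "\<And>v. C_k k (\<lambda>x. D x v)"
  shows "C_k (Suc k) f"
proof -
  have "frechet_derivative f (at x) = D x" for x
    using frechet_derivative_at[OF assms(1)] by simp
  then show ?thesis using assms by (auto simp: differentiable_def)
qed

lemma C_k_Suc_imp: "C_k (Suc k) f \<Longrightarrow> C_k k f"
proof (induction k arbitrary: f)
  case 0
  then show ?case using C_k_continuous by fastforce
next
  case (Suc k)
  then show ?case by (metis C_k.simps(2))
qed

lemma C_k_SucD:
  assumes "C_k (Suc k) f"
  shows "(f has_derivative frechet_derivative f (at x)) (at x)"
    and "C_k k (\<lambda>x. frechet_derivative f (at x) v)"
  using assms by (auto simp: frechet_derivative_works)

lemma C_k_const: "C_k k (\<lambda>x. c)"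
proof (induction k arbitrary: c)
  case (Suc k)
  show ?case by (rule C_k_SucI[where D = "\<lambda>x v. 0"]) (auto simp: Suc)
qed auto

lemma C_k_inner: "C_k k (\<lambda>x. x \<bullet> b)"
proof (cases k)
  case (Suc k')
  show ?thesis unfolding Suc
    by (rule C_k_SucI[where D = "\<lambda>x v. v \<bullet> b"]) (auto intro!: derivative_eq_intros C_k_const)
qed (auto intro!: continuous_intros)

lemma C_k_add: "C_k k f \<Longrightarrow> C_k k g \<Longrightarrow> C_k k (\<lambda>x. f x + g x)"
proof (induction k arbitrary: f g)
  case (Suc k)
  note f = C_k_SucD[OF Suc.prems(1)] and g = C_k_SucD[OF Suc.prems(2)]
  show ?case
  proof (rule C_k_SucI)
    show "((\<lambda>x. f x + g x) has_derivative
        (\<lambda>v. frechet_derivative f (at x) v + frechet_derivative g (at x) v)) (at x)" for x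
      by (rule has_derivative_add[OF f(1) g(1)])
  qed (rule Suc.IH[OF f(2) g(2)])
qed (auto intro: continuous_on_add)

lemma C_k_mult: "C_k k f \<Longrightarrow> C_k k g \<Longrightarrow> C_k k (\<lambda>x. f x * g x)"
proof (induction k arbitrary: f g)
  case (Suc k)
  note f = C_k_SucD[OF Suc.prems(1)] and g = C_k_SucD[OF Suc.prems(2)]
  show ?case
  proof (rule C_k_SucI)
    show "((\<lambda>x. f x * g x) has_derivative
        (\<lambda>v. f x * frechet_derivative g (at x) v + frechet_derivative f (at x) v * g x)) (at x)" for x
      by (rule has_derivative_mult[OF f(1) g(1)])
    show "C_k k (\<lambda>x. f x * frechet_derivative g (at x) v + frechet_derivative f (at x) v * g x)" for v
      by (intro C_k_add Suc.IH[OF C_k_Suc_imp[OF Suc.prems(1)] g(2)]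
          Suc.IH[OF f(2) C_k_Suc_imp[OF Suc.prems(2)]])
  qed
qed (auto intro: continuous_on_mult)

lemma C_k_diff: "C_k k f \<Longrightarrow> C_k k g \<Longrightarrow> C_k k (\<lambda>x. f x - g x)"
  using C_k_add[of k f "\<lambda>x. (-1) * g x"] C_k_mult[OF C_k_const[of k "-1"]] by auto

lemma C_k_prod:
  assumes "finite I" "\<And>i. i \<in> I \<Longrightarrow> C_k k (f i)"
  shows "C_k k (\<lambda>x. \<Prod>i\<in>I. f i x)"
  using assms by (induction I rule: finite_induct) (auto intro: C_k_const C_k_mult)

text \<open>
  The derivative of \<open>exp (- 1 / t) / t ^ m\<close> is a combination of functions of the same form with other
  exponents, so smoothness of compositions has to be proved for the whole family at once: the class
  of functions \<open>F m \<circ> h\<close> is then closed under differentiation up to smooth factors.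
\<close>
lemma C_k_compose_family:
  fixes F :: "nat \<Rightarrow> real \<Rightarrow> real"
  assumes der: "\<And>m t. (F m has_real_derivative (\<Sum>j\<le>n m. c m j * F j t)) (at t)"
    and h: "C_k k h"
  shows "C_k k (\<lambda>x. F m (h x))"
  using h
proof (induction k arbitrary: m)
  case 0
  have "continuous_on UNIV (F m)"
    using der by (intro DERIV_continuous_on) (auto intro: has_field_derivative_at_within)
  then have "continuous_on UNIV (F m \<circ> h)"
    using 0 by (intro continuous_on_compose) (auto intro: continuous_on_subset)
  then show ?case by (simp add: o_def)
next
  case (Suc k)
  have sum: "C_k k (\<lambda>x. \<Sum>j\<in>J. c m j * F j (h x))" if "finite J" for J
    using that
  proof (induction J rule: finite_induct)
    case (insert j J)
    have "C_k k (\<lambda>x. c m j * F j (h x))"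
      by (rule C_k_mult[OF C_k_const Suc.IH[OF C_k_Suc_imp[OF Suc.prems]]])
    from C_k_add[OF this insert.IH] show ?case using insert.hyps by simp
  qed (simp add: C_k_const)
  show ?case
  proof (rule C_k_SucI)
    fix x
    show "((\<lambda>x. F m (h x)) has_derivative
        (\<lambda>v. frechet_derivative h (at x) v * (\<Sum>j\<le>n m. c m j * F j (h x)))) (at x)"
      using has_derivative_compose[OF C_k_SucD(1)[OF Suc.prems]
          der[of m, THEN has_field_derivative_imp_has_derivative], of x] by (simp add: mult.commute)
  next
    fix v
    show "C_k k (\<lambda>x. frechet_derivative h (at x) v * (\<Sum>j\<le>n m. c m j * F j (h x)))"
      by (rule C_k_mult[OF C_k_SucD(2)[OF Suc.prems] sum]) simp
  qed
qed

text \<open>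
  The functions \<open>exp (- 1 / t) / t ^ m\<close>, extended by \<open>0\<close> to the left half-line. The exponent \<open>0\<close> is the usual
  flat function; the others are what its derivatives are made of.
\<close>
definition flat_exp :: "nat \<Rightarrow> real \<Rightarrow> real" where
  "flat_exp m t = (if t > 0 then exp (- 1 / t) / t ^ m else 0)"

lemma flat_exp_tendsto: "((\<lambda>t. exp (- 1 / t) / t ^ m) \<longlongrightarrow> 0) (at_right (0::real))"
proof -
  have "((\<lambda>x::real. x ^ m / exp x) \<longlongrightarrow> 0) at_top" by (rule tendsto_power_div_exp_0)
  from filterlim_compose[OF this filterlim_inverse_at_top_right]
  have "((\<lambda>t. inverse t ^ m / exp (inverse t)) \<longlongrightarrow> 0) (at_right (0::real))" .
  then show ?thesis
    by (simp add: exp_minus field_simps)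
qed

text \<open>
  The difference quotient at \<open>0\<close> from the right is \<open>exp (- 1 / t) / t ^ (m + 1)\<close>, which vanishes in the
  limit because the exponential beats every power.
\<close>
lemma flat_exp_deriv_0: "(flat_exp m has_real_derivative 0) (at 0)"
proof -
  have "((\<lambda>h. (flat_exp m (0 + h) - flat_exp m 0) / h) \<longlongrightarrow> 0) (at 0)"
    unfolding filterlim_at_split
  proof
    show "((\<lambda>h. (flat_exp m (0 + h) - flat_exp m 0) / h) \<longlongrightarrow> 0) (at_left 0)"
      by (rule tendsto_eventually) (auto simp: flat_exp_def eventually_at_filter)
    show "((\<lambda>h. (flat_exp m (0 + h) - flat_exp m 0) / h) \<longlongrightarrow> 0) (at_right 0)"
      by (rule Lim_transform_eventually[OF flat_exp_tendsto[of "Suc m"]])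
        (auto simp: flat_exp_def eventually_at_filter)
  qed
  then show ?thesis by (simp add: DERIV_def)
qed

lemma flat_exp_deriv:
  "(flat_exp m has_real_derivative flat_exp (m + 2) t - real m * flat_exp (Suc m) t) (at t)"
proof -
  consider "t < 0" | "t = 0" | "t > 0" by linarith
  then show ?thesis
  proof cases
    case 1
    have "((\<lambda>_. 0) has_real_derivative 0) (at t)" by simp
    then have "(flat_exp m has_real_derivative 0) (at t)"
      by (rule has_field_derivative_transform_within_open[where S = "{..<0}"])
        (use 1 in \<open>auto simp: flat_exp_def\<close>)
    then show ?thesis using 1 by (simp add: flat_exp_def)
  next
    case 2
    then show ?thesis using flat_exp_deriv_0[of m] by (simp add: flat_exp_def)
  next
    case 3
    have "((\<lambda>t. exp (- 1 / t) / t ^ m) has_real_derivative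
            exp (- 1 / t) / t ^ (m + 2) - real m * (exp (- 1 / t) / t ^ Suc m)) (at t)"
      using 3
      by (auto intro!: derivative_eq_intros simp: field_simps power2_eq_square)
        (cases m; cases "m - 1"; simp)
    then have "(flat_exp m has_real_derivative
            exp (- 1 / t) / t ^ (m + 2) - real m * (exp (- 1 / t) / t ^ Suc m)) (at t)"
      by (rule has_field_derivative_transform_within_open[where S = "{0<..}"])
        (use 3 in \<open>auto simp: flat_exp_def\<close>)
    then show ?thesis using 3 by (simp add: flat_exp_def)
  qed
qed

lemma C_k_flat_exp: "C_k k h \<Longrightarrow> C_k k (\<lambda>x. flat_exp m (h x))"
proof (rule C_k_compose_family[where n = "\<lambda>m. m + 2" and F = flat_exp and
      c = "\<lambda>m j. (if j = m + 2 then 1 else 0) - (if j = Suc m then real m else 0)"])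
  fix m t
  have "(\<Sum>j\<le>m + 2. ((if j = m + 2 then 1 else 0) - (if j = Suc m then real m else 0)) * flat_exp j t)
     = flat_exp (m + 2) t - real m * flat_exp (Suc m) t"
    by (simp add: left_diff_distrib sum_subtractf if_distrib[of "\<lambda>c. c * _"] cong: if_cong)
  then show "(flat_exp m has_real_derivative (\<Sum>j\<le>m + 2.
      ((if j = m + 2 then 1 else 0) - (if j = Suc m then real m else 0)) * flat_exp j t)) (at t)"
    using flat_exp_deriv[of m t] by simp
qed

lemma C_k_exp: "C_k k h \<Longrightarrow> C_k k (\<lambda>x. exp (h x))"
  by (rule C_k_compose_family[where F = "\<lambda>_. exp" and n = "\<lambda>_. 0" and c = "\<lambda>_ _. 1"])
    (auto intro!: derivative_eq_intros)

definition box_bump :: "'a::euclidean_space \<Rightarrow> 'a \<Rightarrow> 'a \<Rightarrow> real" where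
  "box_bump a b x = (\<Prod>i\<in>Basis. flat_exp 0 (x \<bullet> i - a \<bullet> i) * flat_exp 0 (b \<bullet> i - x \<bullet> i))"

lemma C_k_box_bump: "C_k k (box_bump a b)"
  unfolding box_bump_def
  by (intro C_k_prod C_k_mult C_k_flat_exp C_k_diff C_k_inner C_k_const) auto

lemma box_bump_pos_iff: "box_bump a b x > 0 \<longleftrightarrow> x \<in> box a b"
  and box_bump_eq_0: "x \<notin> box a b \<Longrightarrow> box_bump a b x = 0"
proof -
  have 1: "box_bump a b x > 0" if "x \<in> box a b"
    using that unfolding box_bump_def by (intro prod_pos) (auto simp: flat_exp_def mem_box)
  have 2: "box_bump a b x = 0" if "x \<notin> box a b"
    using that unfolding box_bump_def by (auto simp: flat_exp_def mem_box intro!: prod_zero)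
  show "box_bump a b x > 0 \<longleftrightarrow> x \<in> box a b" using 1 2 by force
  show "x \<notin> box a b \<Longrightarrow> box_bump a b x = 0" by (rule 2)
qed

text \<open>
  Since \<open>box_bump\<close> is positive exactly on the open box, \<open>1 - exp (- n * box_bump)\<close> increases to the indicator
  of the box; this avoids the quotients of the usual smooth step functions.
\<close>
definition box_cutoff :: "'a::euclidean_space \<Rightarrow> 'a \<Rightarrow> nat \<Rightarrow> 'a \<Rightarrow> real" where
  "box_cutoff a b n x = 1 - exp (- real n * box_bump a b x)"

lemma smooth_cutoff:
  fixes a b :: "'a::euclidean_space"
  assumes "cbox a b \<subseteq> \<Omega>"
  shows "box_cutoff a b n \<in> test_funs \<Omega>"
    and "0 \<le> box_cutoff a b n x" and "box_cutoff a b n x \<le> indicator (cbox a b) x"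
    and "(\<lambda>n. box_cutoff a b n x) \<longlonglongrightarrow> indicator (box a b) x"
    and "x \<in> box a b \<Longrightarrow> box_cutoff a b (Suc n) x > 0"
proof -
  have nonneg: "box_bump a b x \<ge> 0" for x
    using box_bump_pos_iff[of a b x] box_bump_eq_0[of x a b] by force
  have supp: "closure {x. box_cutoff a b n x \<noteq> 0} \<subseteq> cbox a b"
    by (rule closure_minimal) (use box_bump_eq_0 box_subset_cbox in \<open>auto simp: box_cutoff_def, fastforce\<close>)
  moreover have "smooth_fun (box_cutoff a b n)"
    unfolding smooth_fun_def box_cutoff_def
    by (intro allI C_k_diff C_k_const C_k_exp C_k_mult C_k_box_bump)
  moreover have "compact (closure {x. box_cutoff a b n x \<noteq> 0})"
    using supp by (meson bounded_cbox bounded_subset closed_closure compact_eq_bounded_closed)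
  ultimately show "box_cutoff a b n \<in> test_funs \<Omega>"
    using assms(1) by (auto simp: test_funs_def)
  show "0 \<le> box_cutoff a b n x" using nonneg[of x] by (auto simp: box_cutoff_def)
  show "box_cutoff a b n x \<le> indicator (cbox a b) x"
    using box_bump_eq_0[of x a b] box_subset_cbox[of a b]
    by (cases "x \<in> box a b") (auto simp: box_cutoff_def indicator_def)
  show "(\<lambda>n. box_cutoff a b n x) \<longlonglongrightarrow> indicator (box a b) x"
  proof (cases "x \<in> box a b")
    case True
    then have pos: "box_bump a b x > 0" by (simp add: box_bump_pos_iff)
    have "(\<lambda>n. exp (- box_bump a b x) ^ n) \<longlonglongrightarrow> 0"
      using pos by (intro LIMSEQ_realpow_zero) auto
    then have "(\<lambda>n. 1 - exp (- box_bump a b x) ^ n) \<longlonglongrightarrow> 1 - 0"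
      by (rule tendsto_diff[OF tendsto_const])
    then show ?thesis using True by (simp add: box_cutoff_def exp_of_nat_mult[symmetric])
  qed (simp add: box_cutoff_def box_bump_eq_0)
  show "x \<in> box a b \<Longrightarrow> box_cutoff a b (Suc n) x > 0"
    using box_bump_pos_iff[of a b x] by (simp add: box_cutoff_def mult_less_0_iff)
qed

section \<open>The fundamental lemma and uniqueness of weak gradients\<close>

lemma test_funsD:
  assumes "\<phi> \<in> test_funs \<Omega>"
  shows "C_k k \<phi>" and "compact (closure {x. \<phi> x \<noteq> 0})" and "closure {x. \<phi> x \<noteq> 0} \<subseteq> \<Omega>"
    and "x \<notin> closure {x. \<phi> x \<noteq> 0} \<Longrightarrow> \<phi> x = 0"
  using assms closure_subset[of "{x. \<phi> x \<noteq> 0}"] unfolding test_funs_def smooth_fun_def by blast+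

lemma test_funs_continuous: "\<phi> \<in> test_funs \<Omega> \<Longrightarrow> continuous_on UNIV \<phi>"
  using test_funsD(1)[of \<phi> \<Omega> 0] by simp

lemma loc_integrable_indicator:
  fixes u :: "'a::euclidean_space \<Rightarrow> real"
  assumes "loc_integrable \<Omega> u" "compact K" "K \<subseteq> \<Omega>"
  shows "integrable lebesgue (\<lambda>x. indicator K x * u x)"
  using assms by (auto simp: loc_integrable_def integrable_restrict_space lmeasurable_compact fmeasurableD)

text \<open>
  The pairings in the definition of the weak gradient converge absolutely.
\<close>
lemma integrable_mult_continuous_compact_support:
  fixes u :: "'a::euclidean_space \<Rightarrow> real"
  assumes u: "loc_integrable \<Omega> u" and \<Omega>: "open \<Omega>" and \<psi>: "continuous_on UNIV \<psi>"
    and K: "compact K" "K \<subseteq> \<Omega>" and supp: "\<And>x. x \<notin> K \<Longrightarrow> \<psi> x = 0"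
  shows "integrable (lebesgue_on \<Omega>) (\<lambda>x. u x * \<psi> x)"
proof -
  have sets: "\<Omega> \<in> sets lebesgue" using \<Omega> by simp
  note int = loc_integrable_indicator[OF u K]
  have "bounded (\<psi> ` K)"
    using \<psi> K(1) by (meson compact_continuous_image compact_imp_bounded continuous_on_subset subset_UNIV)
  then obtain M where M: "\<And>x. x \<in> K \<Longrightarrow> \<bar>\<psi> x\<bar> \<le> M"
    by (auto simp: bounded_iff)
  have [measurable]: "\<psi> \<in> borel_measurable lebesgue"
    using borel_measurable_continuous_onI[OF \<psi>] by (simp add: measurable_completion)
  have "integrable lebesgue (\<lambda>x. indicator K x * u x * \<psi> x)"
  proof (rule Bochner_Integration.integrable_bound)
    show "integrable lebesgue (\<lambda>x. M * (indicator K x * u x))" using int by simp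
    show "(\<lambda>x. indicator K x * u x * \<psi> x) \<in> borel_measurable lebesgue"
      using borel_measurable_integrable[OF int] by measurable
    show "AE x in lebesgue. norm (indicator K x * u x * \<psi> x) \<le> norm (M * (indicator K x * u x))"
    proof (rule AE_I2)
      fix x
      show "norm (indicator K x * u x * \<psi> x) \<le> norm (M * (indicator K x * u x))"
        using mult_right_mono[OF order.trans[OF M abs_ge_self], of x "\<bar>u x\<bar>"]
        by (auto simp: indicator_def abs_mult mult.commute)
    qed
  qed
  also have "(\<lambda>x. indicator K x * u x * \<psi> x) = (\<lambda>x. indicator \<Omega> x *\<^sub>R (u x * \<psi> x))"
    using supp K(2) by (auto simp: indicator_def fun_eq_iff)
  finally show "integrable (lebesgue_on \<Omega>) (\<lambda>x. u x * \<psi> x)"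
    using sets by (simp add: integrable_restrict_space)
qed

text \<open>
  Smooth cutoffs converge boundedly to the indicator of the box, and all of them live in the closed box,
  where \<open>g\<close> is integrable: dominated convergence.
\<close>
lemma integral_box_eq_0:
  fixes g :: "'a::euclidean_space \<Rightarrow> real"
  assumes g: "loc_integrable \<Omega> g" and \<Omega>: "open \<Omega>" and ab: "cbox a b \<subseteq> \<Omega>"
    and zero: "\<And>\<phi>. \<phi> \<in> test_funs \<Omega> \<Longrightarrow> (LINT x|lebesgue_on \<Omega>. g x * \<phi> x) = 0"
  shows "(LINT x|lebesgue. indicator (box a b) x * g x) = 0"
proof -
  define \<phi> where "\<phi> = box_cutoff a b"
  note cut = smooth_cutoff[OF ab, folded \<phi>_def]
  note int = loc_integrable_indicator[OF g compact_cbox ab]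
  have out: "\<phi> n x = 0" if "x \<notin> cbox a b" for n x
    using box_bump_eq_0[of x a b] box_subset_cbox[of a b] that by (auto simp: \<phi>_def box_cutoff_def)
  have [measurable]: "\<phi> n \<in> borel_measurable lebesgue" for n
    using borel_measurable_continuous_onI[OF test_funs_continuous[OF cut(1)]]
    by (simp add: measurable_completion)
  have meas: "(\<lambda>x. indicator (cbox a b) x * g x) \<in> borel_measurable lebesgue"
    using int by auto
  have "(LINT x|lebesgue. indicator (cbox a b) x * g x * \<phi> n x) = 0" for n
  proof -
    have "0 = (LINT x|lebesgue_on \<Omega>. g x * \<phi> n x)" using zero[OF cut(1)] by simp
    also have "\<dots> = (LINT x|lebesgue. indicator \<Omega> x *\<^sub>R (g x * \<phi> n x))"
      using \<Omega> by (intro integral_restrict_space) auto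
    also have "\<dots> = (LINT x|lebesgue. indicator (cbox a b) x * g x * \<phi> n x)"
      using out ab by (intro Bochner_Integration.integral_cong) (auto simp: indicator_def)
    finally show ?thesis by simp
  qed
  moreover have "(\<lambda>n. LINT x|lebesgue. indicator (cbox a b) x * g x * \<phi> n x)
      \<longlonglongrightarrow> (LINT x|lebesgue. indicator (cbox a b) x * g x * indicator (box a b) x)"
  proof (rule integral_dominated_convergence)
    show "integrable lebesgue (\<lambda>x. \<bar>indicator (cbox a b) x * g x\<bar>)" using int by simp
    show "AE x in lebesgue. (\<lambda>n. indicator (cbox a b) x * g x * \<phi> n x)
        \<longlonglongrightarrow> indicator (cbox a b) x * g x * indicator (box a b) x"
      by (intro AE_I2 tendsto_mult tendsto_const cut(4))
    show "AE x in lebesgue. norm (indicator (cbox a b) x * g x * \<phi> n x)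
        \<le> \<bar>indicator (cbox a b) x * g x\<bar>" for n
    proof (rule AE_I2)
      fix x
      have "0 \<le> \<phi> n x" "\<phi> n x \<le> 1"
        using cut(2,3)[of n x] by (auto intro: order.trans simp: indicator_def split: if_splits)
      then show "norm (indicator (cbox a b) x * g x * \<phi> n x) \<le> \<bar>indicator (cbox a b) x * g x\<bar>"
        by (simp add: abs_mult mult_left_le)
    qed
    show "(\<lambda>x. indicator (cbox a b) x * g x * indicator (box a b) x) \<in> borel_measurable lebesgue"
      by (rule borel_measurable_times[OF meas]) (intro borel_measurable_indicator, simp)
    show "(\<lambda>x. indicator (cbox a b) x * g x * \<phi> n x) \<in> borel_measurable lebesgue" for n
      by (rule borel_measurable_times[OF meas]) simp
  qed
  ultimately have "(LINT x|lebesgue. indicator (cbox a b) x * g x * indicator (box a b) x) = 0"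
    by (simp add: LIMSEQ_const_iff)
  moreover have "indicator (cbox a b) x * g x * indicator (box a b) x = indicator (box a b) x * g x" for x
    using box_subset_cbox[of a b] by (auto simp: indicator_def)
  ultimately show ?thesis by simp
qed

text \<open>
  The boxes are stable under intersection and generate the Borel sets. The sets over which the integral
  vanishes form a Dynkin system, with closure under complements due to \<open>total\<close>, and so contain all Borel sets.
\<close>
lemma AE_eq_0_if_integral_boxes_eq_0:
  fixes f :: "'a::euclidean_space \<Rightarrow> real"
  assumes f: "integrable lebesgue f"
    and zero: "\<And>a b. (LINT x|lebesgue. indicator (box a b) x * f x) = 0"
    and total: "integral\<^sup>L lebesgue f = 0"
  shows "AE x in lebesgue. f x = 0"
proof -
  obtain f' where f'[measurable]: "f' \<in> borel_measurable lborel" and ae: "AE x in lebesgue. f x = f' x"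
    using completion_ex_borel_measurable_real[OF borel_measurable_integrable[OF f]]
    by (auto intro: AE_completion)
  have int_lebesgue: "integrable lebesgue f'"
    using f ae by (subst integrable_cong_AE[symmetric, OF _ _ ae]) (auto simp: measurable_completion)
  then have int: "integrable lborel f'" by (simp add: integrable_completion)
  have eq: "(LINT x|lborel. indicator A x * f' x) = (LINT x|lebesgue. indicator A x * f x)"
    if [measurable]: "A \<in> sets borel" for A
  proof -
    have "(LINT x|lborel. indicator A x * f' x) = (LINT x|lebesgue. indicator A x * f' x)"
      by (simp add: integral_completion)
    also have "\<dots> = (LINT x|lebesgue. indicator A x * f x)"
      using ae f by (intro integral_cong_AE) (auto intro!: borel_measurable_times simp: measurable_completion)
    finally show ?thesis .
  qed
  have int_A: "integrable lborel (\<lambda>x. indicator A x * f' x)" if "A \<in> sets borel" for A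
    using integrable_mult_indicator[OF _ int, of A] that by simp
  have total': "integral\<^sup>L lborel f' = 0"
    using eq[of UNIV] total by simp
  have dynkin: "(LINT x|lborel. indicator A x * f' x) = 0" if "A \<in> sets borel" for A
  proof -
    have "Int_stable (range (\<lambda>(a, b). box a b :: 'a set))"
      by (auto simp: Int_stable_def box_Int_box)
    moreover have "range (\<lambda>(a, b). box a b :: 'a set) \<subseteq> Pow UNIV" by simp
    moreover have "A \<in> sigma_sets UNIV (range (\<lambda>(a, b). box a b :: 'a set))"
      using that by (subst (asm) borel_eq_box) simp
    ultimately show ?thesis
    proof (induction rule: sigma_sets_induct_disjoint)
      case (basic A)
      then show ?case using eq zero by auto
    next
      case (compl A)
      then have A: "A \<in> sets borel" by (simp add: borel_eq_box)
      have "(LINT x|lborel. indicator (UNIV - A) x * f' x) = (LINT x|lborel. f' x - indicator A x * f' x)"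
        by (intro Bochner_Integration.integral_cong) (auto simp: indicator_def)
      also have "\<dots> = 0" using compl.IH int int_A[OF A] total' by simp
      finally show ?case .
    next
      case (union A)
      then have A: "A i \<in> sets borel" for i by (auto simp: borel_eq_box)
      have "(LINT x:(\<Union>i. A i)|lborel. f' x) = (\<Sum>i. LINT x:A i|lborel. f' x)"
        using A union(1) int_A[of "\<Union>i. A i"]
        by (intro lebesgue_integral_countable_add)
          (auto simp: disjoint_family_on_def set_integrable_def)
      then show ?case using union.IH by (simp add: set_lebesgue_integral_def)
    qed auto
  qed
  have "AE x in lborel. f' x = 0"
    by (rule density_unique_real[OF int]) (use dynkin in \<open>auto simp: set_lebesgue_integral_def\<close>)
  then have "AE x in lebesgue. f' x = 0" by (rule AE_completion)
  with ae show ?thesis by eventually_elim simp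
qed

text \<open>
  Locally \<open>g\<close> is integrable and its integral over every box vanishes; countably many closed boxes
  cover \<open>\<Omega>\<close>.
\<close>
lemma fundamental_lemma:
  fixes g :: "'a::euclidean_space \<Rightarrow> real"
  assumes g: "loc_integrable \<Omega> g" and \<Omega>: "open \<Omega>"
    and zero: "\<And>\<phi>. \<phi> \<in> test_funs \<Omega> \<Longrightarrow> (LINT x|lebesgue_on \<Omega>. g x * \<phi> x) = 0"
  shows "AE x in lebesgue_on \<Omega>. g x = 0"
proof -
  have on_cbox: "AE x in lebesgue. x \<in> cbox c d \<longrightarrow> g x = 0" if cd: "cbox c d \<subseteq> \<Omega>" for c d
  proof -
    note int = loc_integrable_indicator[OF g compact_cbox cd]
    have "integrable lebesgue (\<lambda>x. indicator (box c d) x *\<^sub>R (indicator (cbox c d) x * g x))"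
      by (rule integrable_mult_indicator[OF _ int]) simp
    also have "(\<lambda>x. indicator (box c d) x *\<^sub>R (indicator (cbox c d) x * g x)) = (\<lambda>x. indicator (box c d) x * g x)"
      using box_subset_cbox[of c d] by (auto simp: indicator_def fun_eq_iff)
    finally have int': "integrable lebesgue (\<lambda>x. indicator (box c d) x * g x)" .
    have "AE x in lebesgue. indicator (box c d) x * g x = 0"
    proof (rule AE_eq_0_if_integral_boxes_eq_0[OF int'])
      fix a b :: 'a
      define a' b' where "a' = (\<Sum>i\<in>Basis. max (a \<bullet> i) (c \<bullet> i) *\<^sub>R i)"
        and "b' = (\<Sum>i\<in>Basis. min (b \<bullet> i) (d \<bullet> i) *\<^sub>R i)"
      show "(LINT x|lebesgue. indicator (box a b) x * (indicator (box c d) x * g x)) = 0"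
      proof (cases "box a b \<inter> box c d = {}")
        case True
        then have "indicator (box a b) x * (indicator (box c d) x * g x) = 0" for x
          by (auto simp: indicator_def)
        then show ?thesis by (simp only: Bochner_Integration.integral_zero)
      next
        case False
        have inter: "box a b \<inter> box c d = box a' b'"
          by (simp add: a'_def b'_def box_Int_box)
        have "cbox a' b' \<subseteq> cbox c d"
          by (auto simp: mem_box a'_def b'_def)
        then have "(LINT x|lebesgue. indicator (box a' b') x * g x) = 0"
          using cd by (intro integral_box_eq_0[OF g \<Omega> _ zero]) auto
        then show ?thesis
          by (simp add: inter[symmetric] indicator_inter_arith mult.assoc)
      qed
    qed (rule integral_box_eq_0[OF g \<Omega> cd zero])
    moreover have "cbox c d - box c d \<in> null_sets lebesgue"
      using negligible_frontier_interval[of c d] by (simp add: negligible_iff_null_sets)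
    then have "AE x in lebesgue. x \<notin> cbox c d - box c d" by (rule AE_not_in)
    ultimately show ?thesis by eventually_elim (auto simp: indicator_def split: if_splits)
  qed
  obtain D where D: "countable D" "\<And>X. X \<in> D \<Longrightarrow> X \<subseteq> \<Omega> \<and> (\<exists>c d. X = cbox c d)" "\<Union>D = \<Omega>"
    using open_countable_Union_open_cbox[OF \<Omega>] by (metis Pow_iff subsetD)
  have "AE x in lebesgue. \<forall>X\<in>D. x \<in> X \<longrightarrow> g x = 0"
    using D(1,2) on_cbox by (subst AE_ball_countable) (auto, metis)
  then have "AE x in lebesgue. x \<in> \<Omega> \<longrightarrow> g x = 0"
    by eventually_elim (use D(3) in auto)
  then show ?thesis using \<Omega> by (subst AE_restrict_space_iff) auto
qed

lemma frechet_derivative_eq_0_outside: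
  assumes "x \<notin> closure {x. \<phi> x \<noteq> 0}"
  shows "frechet_derivative \<phi> (at x) v = 0"
proof -
  have "((\<lambda>_. 0) has_derivative (\<lambda>_. 0)) (at x)" by simp
  then have "(\<phi> has_derivative (\<lambda>_. 0)) (at x)"
    by (rule has_derivative_transform_within_open[where s = "- closure {x. \<phi> x \<noteq> 0}"])
      (use assms closure_subset[of "{x. \<phi> x \<noteq> 0}"] in auto)
  then show ?thesis using frechet_derivative_at[of \<phi> "\<lambda>_. 0" x] by (simp add: fun_eq_iff)
qed

lemma weak_gradient_integrable:
  fixes u :: "'a::euclidean_space \<Rightarrow> real" and b :: 'a
  assumes "has_weak_gradient \<Omega> u g" "open \<Omega>" "\<phi> \<in> test_funs \<Omega>"
  shows "integrable (lebesgue_on \<Omega>) (\<lambda>x. u x * frechet_derivative \<phi> (at x) b)"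
    and "integrable (lebesgue_on \<Omega>) (\<lambda>x. (g x \<bullet> b) * \<phi> x)"
proof -
  note T = test_funsD[OF assms(3)]
  show "integrable (lebesgue_on \<Omega>) (\<lambda>x. u x * frechet_derivative \<phi> (at x) b)"
    using assms C_k_SucD(2)[OF T(1), of 0 b] T(2,3)
    by (intro integrable_mult_continuous_compact_support[where K = "closure {x. \<phi> x \<noteq> 0}"])
      (auto simp: has_weak_gradient_def frechet_derivative_eq_0_outside)
  have *: "loc_integrable \<Omega> (\<lambda>x. g x \<bullet> b)"
    using assms(1) by (auto simp: has_weak_gradient_def loc_integrable_def)
  show "integrable (lebesgue_on \<Omega>) (\<lambda>x. (g x \<bullet> b) * \<phi> x)"
    by (rule integrable_mult_continuous_compact_support[OF * assms(2) test_funs_continuous[OF assms(3)] T(2,3,4)])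
qed

lemma has_weak_gradient_diff:
  fixes \<Omega> :: "'a::euclidean_space set"
  assumes u: "has_weak_gradient \<Omega> u g" and v: "has_weak_gradient \<Omega> v h" and \<Omega>: "open \<Omega>"
  shows "has_weak_gradient \<Omega> (\<lambda>x. u x - v x) (\<lambda>x. g x - h x)"
  unfolding has_weak_gradient_def
proof (intro conjI ballI)
  show "loc_integrable \<Omega> (\<lambda>x. u x - v x)" "loc_integrable \<Omega> (\<lambda>x. g x - h x)"
    using u v by (auto simp: has_weak_gradient_def loc_integrable_def)
  fix \<phi> and b :: 'a assume \<phi>: "\<phi> \<in> test_funs \<Omega>" and b: "b \<in> Basis"
  note iu = weak_gradient_integrable[OF u \<Omega> \<phi>, of b] and iv = weak_gradient_integrable[OF v \<Omega> \<phi>, of b]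
  show "(LINT x|lebesgue_on \<Omega>. (u x - v x) * frechet_derivative \<phi> (at x) b)
      = - (LINT x|lebesgue_on \<Omega>. ((g x - h x) \<bullet> b) * \<phi> x)"
    using iu iv u v \<phi> b by (simp add: left_diff_distrib inner_diff_left has_weak_gradient_def)
qed

lemma has_weak_gradient_unique:
  fixes \<Omega> :: "'a::euclidean_space set"
  assumes g: "has_weak_gradient \<Omega> u g" and h: "has_weak_gradient \<Omega> u h" and \<Omega>: "open \<Omega>"
  shows "AE x in lebesgue_on \<Omega>. g x = h x"
proof -
  have d: "has_weak_gradient \<Omega> (\<lambda>x. u x - u x) (\<lambda>x. g x - h x)"
    by (rule has_weak_gradient_diff[OF g h \<Omega>])
  have "AE x in lebesgue_on \<Omega>. \<forall>b\<in>Basis. (g x - h x) \<bullet> b = 0"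
  proof (subst AE_ball_countable, simp add: countable_finite, intro ballI)
    fix b :: 'a assume b: "b \<in> Basis"
    show "AE x in lebesgue_on \<Omega>. (g x - h x) \<bullet> b = 0"
    proof (rule fundamental_lemma[OF _ \<Omega>])
      show "loc_integrable \<Omega> (\<lambda>x. (g x - h x) \<bullet> b)"
        using d by (auto simp: has_weak_gradient_def loc_integrable_def)
      show "(LINT x|lebesgue_on \<Omega>. (g x - h x) \<bullet> b * \<phi> x) = 0" if "\<phi> \<in> test_funs \<Omega>" for \<phi>
        using d b that by (simp add: has_weak_gradient_def)
    qed
  qed
  then show ?thesis by eventually_elim (metis euclidean_eqI inner_diff_left eq_iff_diff_eq_0)
qed

lemma has_weak_gradient_weak_gradient:
  "has_weak_gradient \<Omega> u g \<Longrightarrow> has_weak_gradient \<Omega> u (weak_gradient \<Omega> u)"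
  unfolding weak_gradient_def by (rule someI[of "has_weak_gradient \<Omega> u"])

text \<open>
  The chosen representative agrees with any known weak gradient, so norms may be computed with the latter.
\<close>
lemma weak_gradient_AE_eq:
  "has_weak_gradient \<Omega> u g \<Longrightarrow> open \<Omega> \<Longrightarrow> AE x in lebesgue_on \<Omega>. weak_gradient \<Omega> u x = g x"
  using has_weak_gradient_unique has_weak_gradient_weak_gradient by blast

section \<open>Classical gradients are weak gradients\<close>

definition grad :: "('a::euclidean_space \<Rightarrow> real) \<Rightarrow> 'a \<Rightarrow> 'a" where
  "grad \<phi> x = (\<Sum>b\<in>Basis. frechet_derivative \<phi> (at x) b *\<^sub>R b)"

lemma grad_inner:
  assumes "\<phi> differentiable (at x)"
  shows "grad \<phi> x \<bullet> v = frechet_derivative \<phi> (at x) v"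
proof -
  interpret bounded_linear "frechet_derivative \<phi> (at x)"
    using assms frechet_derivative_works has_derivative_bounded_linear by blast
  have "frechet_derivative \<phi> (at x) v = frechet_derivative \<phi> (at x) (\<Sum>b\<in>Basis. (v \<bullet> b) *\<^sub>R b)"
    by (simp add: euclidean_representation)
  also have "\<dots> = grad \<phi> x \<bullet> v"
    by (simp add: sum scaleR grad_def inner_sum_right mult.commute inner_commute[of _ v])
  finally show ?thesis ..
qed

text \<open>
  Along lines the mean value theorem and the fundamental theorem of calculus become available.
\<close>
lemma line_derivative:
  assumes "C_k (Suc k) \<phi>"
  shows "((\<lambda>t. \<phi> (x + t *\<^sub>R v)) has_real_derivative grad \<phi> (x + t *\<^sub>R v) \<bullet> v) (at t)"
proof -
  have d: "\<phi> differentiable (at y)" for y using assms by simp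
  interpret bounded_linear "frechet_derivative \<phi> (at (x + t *\<^sub>R v))"
    using d frechet_derivative_works has_derivative_bounded_linear by blast
  have "((\<lambda>t. x + t *\<^sub>R v) has_derivative (\<lambda>h. h *\<^sub>R v)) (at t)"
    by (auto intro!: derivative_eq_intros)
  from has_derivative_compose[OF this d[THEN frechet_derivative_works[THEN iffD1]]]
  show ?thesis
    by (rule has_derivative_imp_has_field_derivative) (simp add: scaleR grad_inner[OF d])
qed

lemma continuous_on_grad: "C_k (Suc k) \<phi> \<Longrightarrow> continuous_on UNIV (grad \<phi>)"
  unfolding grad_def by (intro continuous_intros C_k_continuous[OF C_k_SucD(2)])

lemma grad_eq_0_outside: "x \<notin> closure {x. \<phi> x \<noteq> 0} \<Longrightarrow> grad \<phi> x = 0"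
  by (simp add: grad_def frechet_derivative_eq_0_outside)

lemma integrable_continuous_compact_support:
  fixes f :: "'a::euclidean_space \<Rightarrow> 'b::euclidean_space"
  assumes "continuous_on UNIV f" "compact K" "\<And>x. x \<notin> K \<Longrightarrow> f x = 0"
  shows "integrable lborel f"
proof -
  have "integrable lborel (\<lambda>x. indicator K x *\<^sub>R f x)"
    using assms by (intro borel_integrable_compact) (auto intro: continuous_on_subset)
  also have "(\<lambda>x. indicator K x *\<^sub>R f x) = f"
    using assms(3) by (auto simp: indicator_def)
  finally show ?thesis .
qed

lemma bounded_continuous_compact_support:
  fixes f :: "'a::euclidean_space \<Rightarrow> 'b::euclidean_space"
  assumes "continuous_on UNIV f" "compact K" "\<And>x. x \<notin> K \<Longrightarrow> f x = 0"
  obtains M where "M \<ge> 0" "\<And>x. norm (f x) \<le> M"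
proof -
  have "bounded (f ` K)"
    using assms by (meson compact_continuous_image compact_imp_bounded continuous_on_subset subset_UNIV)
  then obtain M where M: "\<And>x. x \<in> K \<Longrightarrow> norm (f x) \<le> M"
    by (auto simp: bounded_iff)
  have "norm (f x) \<le> \<bar>M\<bar>" for x
    using M[of x] assms(3)[of x] by (cases "x \<in> K") auto
  then show ?thesis using that[of "\<bar>M\<bar>"] by simp
qed

text \<open>
  By translation invariance the difference quotients of \<open>F\<close> in direction \<open>v\<close> have integral \<open>0\<close>. They are bounded
  by the mean value theorem and vanish outside a fixed ball, so the limit can be taken under the integral.
\<close>
lemma integral_directional_derivative_eq_0:
  fixes F :: "'a::euclidean_space \<Rightarrow> real"
  assumes F: "C_k (Suc k) F" and K: "compact K" and supp: "\<And>x. x \<notin> K \<Longrightarrow> F x = 0"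
  shows "(LINT x|lborel. grad F x \<bullet> v) = 0"
proof -
  note cont = C_k_continuous[OF F]
  have "closure {x. F x \<noteq> 0} \<subseteq> K"
    using K supp by (intro closure_minimal) (auto intro: compact_imp_closed)
  then have supp': "grad F x = 0" if "x \<notin> K" for x
    using that grad_eq_0_outside by blast
  have int: "integrable lborel F"
    by (rule integrable_continuous_compact_support[OF cont K supp])
  define Q where "Q = (\<lambda>n x. (F (x + inverse (real (Suc n)) *\<^sub>R v) - F x) / inverse (real (Suc n)))"
  obtain M where M: "M \<ge> 0" "\<And>x. norm (grad F x) \<le> M"
    using bounded_continuous_compact_support[OF continuous_on_grad[OF F] K supp'] by metis
  obtain R where R: "\<And>x. x \<in> K \<Longrightarrow> norm x \<le> R"
    using compact_imp_bounded[OF K] by (auto simp: bounded_iff)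
  have [measurable]: "F \<in> borel_measurable borel" "grad F \<in> borel_measurable borel"
    using borel_measurable_continuous_onI cont continuous_on_grad[OF F] by blast+
  have "(\<lambda>n. integral\<^sup>L lborel (Q n)) \<longlonglongrightarrow> (LINT x|lborel. grad F x \<bullet> v)"
  proof (rule integral_dominated_convergence)
    show "integrable lborel (\<lambda>x. M * norm v * indicator (cball 0 (R + norm v)) x)"
      by (intro integrable_mult_right integrable_real_indicator)
        (use emeasure_bounded_finite[OF bounded_cball] in \<open>auto simp: top.not_eq_extremum\<close>)
    show "AE x in lborel. (\<lambda>n. Q n x) \<longlonglongrightarrow> grad F x \<bullet> v"
    proof (rule AE_I2)
      fix x
      have "((\<lambda>h. (F (x + h *\<^sub>R v) - F x) / h) \<longlongrightarrow> grad F x \<bullet> v) (at 0)"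
        using line_derivative[OF F, of x v 0] by (simp add: DERIV_def)
      moreover have "filterlim (\<lambda>n. inverse (real (Suc n))) (at 0) sequentially"
        using LIMSEQ_inverse_real_of_nat by (simp add: filterlim_at)
      ultimately show "(\<lambda>n. Q n x) \<longlonglongrightarrow> grad F x \<bullet> v"
        unfolding Q_def by (rule filterlim_compose)
    qed
    fix n
    show "AE x in lborel. norm (Q n x) \<le> M * norm v * indicator (cball 0 (R + norm v)) x"
    proof (rule AE_I2)
      fix x
      define h where "h = inverse (real (Suc n))"
      have h: "0 < h" "h \<le> 1" by (auto simp: h_def inverse_le_1_iff)
      show "norm (Q n x) \<le> M * norm v * indicator (cball 0 (R + norm v)) x"
      proof (cases "norm x \<le> R + norm v")
        case True
        obtain z where "F (x + h *\<^sub>R v) - F (x + 0 *\<^sub>R v) = (h - 0) * (grad F (x + z *\<^sub>R v) \<bullet> v)"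
          using MVT2[OF h(1) line_derivative[OF F, of x v]] by blast
        then have "Q n x = grad F (x + z *\<^sub>R v) \<bullet> v"
          using h(1) by (simp add: Q_def h_def[symmetric] del: of_nat_Suc)
        also have "\<bar>\<dots>\<bar> \<le> norm (grad F (x + z *\<^sub>R v)) * norm v" by (rule Cauchy_Schwarz_ineq2)
        also have "\<dots> \<le> M * norm v" by (intro mult_right_mono M) auto
        finally show ?thesis using True by simp
      next
        case False
        have "norm (x + h *\<^sub>R v) \<ge> norm x - h * norm v"
          using norm_triangle_ineq4[of "x + h *\<^sub>R v" "h *\<^sub>R v"] h by simp
        moreover have "h * norm v \<le> norm v" using h by (simp add: mult_left_le_one_le)
        ultimately have "\<not> norm (x + h *\<^sub>R v) \<le> R" using False by simp
        moreover have "\<not> norm x \<le> R" using False norm_ge_zero[of v] by linarith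
        ultimately have "F (x + h *\<^sub>R v) = 0" "F x = 0" using R supp by blast+
        then show ?thesis using False by (simp add: Q_def h_def)
      qed
    qed
  qed (auto simp: Q_def)
  moreover have "integral\<^sup>L lborel (Q n) = 0" for n
  proof -
    let ?w = "inverse (real (Suc n)) *\<^sub>R v"
    have "integrable lborel (\<lambda>x. F (?w + x))" "(LINT x|lborel. F (?w + x)) = integral\<^sup>L lborel F"
      using int lborel_distr_plus[of ?w] integrable_distr_eq[of "(+) ?w" lborel borel F]
        integral_distr[of "(+) ?w" lborel borel F] by simp_all
    then show ?thesis using int by (simp add: Q_def add.commute del: of_nat_Suc)
  qed
  ultimately show ?thesis by (simp add: LIMSEQ_const_iff)
qed

lemma integral_lebesgue_on_eq_lborel:
  fixes f :: "'a::euclidean_space \<Rightarrow> 'b::euclidean_space"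
  assumes "f \<in> borel_measurable borel" "\<And>x. x \<notin> \<Omega> \<Longrightarrow> f x = 0" "\<Omega> \<in> sets lebesgue"
  shows "integral\<^sup>L (lebesgue_on \<Omega>) f = integral\<^sup>L lborel f"
    and "integrable (lebesgue_on \<Omega>) f \<longleftrightarrow> integrable lborel f"
proof -
  have eq: "(\<lambda>x. indicator \<Omega> x *\<^sub>R f x) = f"
    using assms(2) by (auto simp: indicator_def)
  show "integral\<^sup>L (lebesgue_on \<Omega>) f = integral\<^sup>L lborel f"
    using assms by (simp add: integral_restrict_space eq integral_completion)
  show "integrable (lebesgue_on \<Omega>) f \<longleftrightarrow> integrable lborel f"
    using assms by (simp add: integrable_restrict_space eq integrable_completion)
qed

lemma integrable_lborel_imp_lebesgue_on:
  fixes f :: "'a::euclidean_space \<Rightarrow> 'b::euclidean_space"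
  assumes "integrable lborel f" "K \<in> sets lebesgue"
  shows "integrable (lebesgue_on K) f"
  using assms integrable_mult_indicator[of K lebesgue f]
  by (simp add: integrable_restrict_space integrable_completion borel_measurable_integrable)

lemma test_fun_integrable:
  assumes "\<phi> \<in> test_funs \<Omega>"
  shows "integrable lborel \<phi>" and "integrable lborel (grad \<phi>)"
proof -
  note T = test_funsD[OF assms]
  show "integrable lborel \<phi>"
    by (rule integrable_continuous_compact_support[OF test_funs_continuous[OF assms] T(2,4)])
  show "integrable lborel (grad \<phi>)"
    by (rule integrable_continuous_compact_support[OF continuous_on_grad[OF T(1)] T(2) grad_eq_0_outside])
qed

text \<open>
  Integration by parts: the gradient of the product of \<open>\<phi>\<close> with a test function has integral \<open>0\<close>.
\<close>
lemma has_weak_gradient_grad: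
  fixes \<Omega> :: "'a::euclidean_space set"
  assumes \<Omega>: "open \<Omega>" and \<phi>: "\<phi> \<in> test_funs \<Omega>"
  shows "has_weak_gradient \<Omega> \<phi> (grad \<phi>)"
  unfolding has_weak_gradient_def
proof (intro conjI ballI)
  show "loc_integrable \<Omega> \<phi>" "loc_integrable \<Omega> (grad \<phi>)"
    using test_fun_integrable[OF \<phi>]
    by (auto simp: loc_integrable_def intro!: integrable_lborel_imp_lebesgue_on fmeasurableD[OF lmeasurable_compact])
  fix \<psi> and b :: 'a assume \<psi>: "\<psi> \<in> test_funs \<Omega>"
  let ?K = "closure {x. \<psi> x \<noteq> 0}"
  note T\<phi> = test_funsD[OF \<phi>] and T\<psi> = test_funsD[OF \<psi>]
  have d: "\<phi> differentiable (at x)" "\<psi> differentiable (at x)" for x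
    using T\<phi>(1)[of 1] T\<psi>(1)[of 1] by auto
  have prod: "C_k 1 (\<lambda>x. \<phi> x * \<psi> x)" by (intro C_k_mult T\<phi> T\<psi>)
  have deriv: "grad (\<lambda>x. \<phi> x * \<psi> x) x \<bullet> b = \<phi> x * frechet_derivative \<psi> (at x) b + (grad \<phi> x \<bullet> b) * \<psi> x" for x
  proof -
    have "((\<lambda>x. \<phi> x * \<psi> x) has_derivative (\<lambda>v. \<phi> x * frechet_derivative \<psi> (at x) v
        + frechet_derivative \<phi> (at x) v * \<psi> x)) (at x)"
      by (intro has_derivative_mult d[THEN frechet_derivative_works[THEN iffD1]])
    from frechet_derivative_at[OF this] show ?thesis
      using prod by (simp add: grad_inner d fun_eq_iff)
  qed
  have cont_d: "continuous_on UNIV (\<lambda>x. frechet_derivative \<psi> (at x) b)"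
    using C_k_continuous[OF C_k_SucD(2)[OF T\<psi>(1)[of "Suc 0"], of b]] .
  have cont_g: "continuous_on UNIV (\<lambda>x. grad \<phi> x \<bullet> b)"
    using continuous_on_inner[OF continuous_on_grad[OF T\<phi>(1)[of "Suc 0"]] continuous_on_const] .
  have c: "continuous_on UNIV (\<lambda>x. \<phi> x * frechet_derivative \<psi> (at x) b)"
    "continuous_on UNIV (\<lambda>x. (grad \<phi> x \<bullet> b) * \<psi> x)"
    using continuous_on_mult[OF test_funs_continuous[OF \<phi>] cont_d]
      continuous_on_mult[OF cont_g test_funs_continuous[OF \<psi>]] .
  have z: "\<phi> x * frechet_derivative \<psi> (at x) b = 0" "(grad \<phi> x \<bullet> b) * \<psi> x = 0" if "x \<notin> ?K" for x
    using T\<psi>(4)[OF that] frechet_derivative_eq_0_outside[OF that] by auto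
  have i: "integrable lborel (\<lambda>x. \<phi> x * frechet_derivative \<psi> (at x) b)"
    "integrable lborel (\<lambda>x. (grad \<phi> x \<bullet> b) * \<psi> x)"
    using integrable_continuous_compact_support[OF c(1) T\<psi>(2) z(1)]
      integrable_continuous_compact_support[OF c(2) T\<psi>(2) z(2)] by auto
  have "(LINT x|lborel. grad (\<lambda>x. \<phi> x * \<psi> x) x \<bullet> b) = 0"
    by (rule integral_directional_derivative_eq_0[OF prod[unfolded One_nat_def] T\<psi>(2)]) (metis T\<psi>(4) mult_zero_right)
  then have I: "(LINT x|lborel. \<phi> x * frechet_derivative \<psi> (at x) b) = - (LINT x|lborel. (grad \<phi> x \<bullet> b) * \<psi> x)"
    using i by (simp add: deriv)
  have "(LINT x|lebesgue_on \<Omega>. f x) = (LINT x|lborel. f x)"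
    if "continuous_on UNIV f" "\<And>x. x \<notin> ?K \<Longrightarrow> f x = 0" for f :: "'a \<Rightarrow> real"
  proof (rule integral_lebesgue_on_eq_lborel(1)[OF borel_measurable_continuous_onI[OF that(1)]])
    show "f x = 0" if "x \<notin> \<Omega>" for x
      using that T\<psi>(3) by (intro \<open>\<And>x. x \<notin> ?K \<Longrightarrow> f x = 0\<close>) (erule contra_subsetD)
    show "\<Omega> \<in> sets lebesgue" using \<Omega> by simp
  qed
  from this[OF c(1) z(1)] this[OF c(2) z(2)] I show "(LINT x|lebesgue_on \<Omega>. \<phi> x * frechet_derivative \<psi> (at x) b)
      = - (LINT x|lebesgue_on \<Omega>. (grad \<phi> x \<bullet> b) * \<psi> x)" by simp
qed

section \<open>Power means and averages over dilated sets\<close>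

text \<open>
  The tangent to \<open>x powr r\<close> at \<open>1\<close>, in the form of Young's inequality.
\<close>
lemma bernoulli_powr:
  fixes x r :: real
  assumes "0 \<le> x" "1 \<le> r"
  shows "r * x \<le> x powr r + (r - 1)"
proof (cases "x = 0")
  case False
  then have "(x powr r) powr (1 / r) * 1 powr (1 - 1 / r) \<le> (1 / r) * x powr r + (1 - 1 / r) * 1"
    using assms by (intro Youngs_inequality_0) auto
  then have "x \<le> (1 / r) * x powr r + (1 - 1 / r)"
    using assms False by (simp add: powr_powr)
  then have "r * x \<le> r * ((1 / r) * x powr r + (1 - 1 / r))"
    using assms by (intro mult_left_mono) auto
  then show ?thesis using assms by (simp add: distrib_left right_diff_distrib)
qed (use assms in auto)

text \<open>
  Jensen's inequality for the power \<open>r\<close>, obtained by integrating the tangent inequality at the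
  mean value \<open>I / m\<close>. Allowing \<open>I\<close> to be any lower bound of the integral, and the right-hand side to be
  infinite, saves integrability side conditions in the applications.
\<close>
lemma power_mean_nn_integral:
  fixes f :: "'a \<Rightarrow> real"
  assumes f[measurable]: "f \<in> borel_measurable M" and nonneg: "\<And>x. x \<in> space M \<Longrightarrow> 0 \<le> f x"
    and m: "emeasure M (space M) = ennreal m" "0 < m"
    and r: "1 \<le> r" and I: "0 \<le> I" "ennreal I \<le> (\<integral>\<^sup>+x. ennreal (f x) \<partial>M)"
  shows "ennreal (I powr r) \<le> ennreal (m powr (r - 1)) * (\<integral>\<^sup>+x. ennreal (f x powr r) \<partial>M)"
proof (cases "I = 0 \<or> (\<integral>\<^sup>+x. ennreal (f x powr r) \<partial>M) = \<infinity>")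
  case True
  then show ?thesis using m by (auto simp: ennreal_mult_top)
next
  case False
  then obtain J where J: "(\<integral>\<^sup>+x. ennreal (f x powr r) \<partial>M) = ennreal J" "0 \<le> J"
    by (cases "\<integral>\<^sup>+x. ennreal (f x powr r) \<partial>M" rule: ennreal_cases) auto
  have I0: "0 < I" using False I by auto
  define a where "a = I / m"
  have a: "0 < a" using I0 m by (simp add: a_def)
  have pw: "r * a powr (r - 1) * f x \<le> f x powr r + (r - 1) * a powr r" if "x \<in> space M" for x
  proof -
    have "r * (f x / a) * a powr r \<le> ((f x / a) powr r + (r - 1)) * a powr r"
      using bernoulli_powr[of "f x / a" r] nonneg[OF that] a r by (intro mult_right_mono) auto
    moreover have "(f x / a) powr r * a powr r = f x powr r"
      using a nonneg[OF that] by (simp add: powr_divide)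
    moreover have "r * (f x / a) * a powr r = r * a powr (r - 1) * f x"
      using a by (simp add: powr_diff)
    ultimately show ?thesis by (simp add: distrib_right)
  qed
  have "ennreal (r * a powr (r - 1) * I) \<le> ennreal (r * a powr (r - 1)) * (\<integral>\<^sup>+x. ennreal (f x) \<partial>M)"
    using I r by (subst ennreal_mult) (auto intro: mult_left_mono)
  also have "\<dots> = (\<integral>\<^sup>+x. ennreal (r * a powr (r - 1) * f x) \<partial>M)"
    using r nonneg by (subst nn_integral_cmult[symmetric]) (auto simp: ennreal_mult intro!: nn_integral_cong)
  also have "\<dots> \<le> (\<integral>\<^sup>+x. ennreal (f x powr r) + ennreal ((r - 1) * a powr r) \<partial>M)"
    using pw r by (intro nn_integral_mono) (simp add: ennreal_plus[symmetric] del: ennreal_plus)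
  also have "\<dots> = ennreal J + ennreal ((r - 1) * a powr r) * ennreal m"
    using J m by (subst nn_integral_add) auto
  also have "\<dots> = ennreal (J + (r - 1) * a powr r * m)"
    using J m r by (simp add: ennreal_mult ennreal_plus)
  finally have "r * a powr (r - 1) * I \<le> J + (r - 1) * a powr r * m"
    using J m r by (subst (asm) ennreal_le_iff) auto
  moreover have "r * a powr (r - 1) * I = r * a powr r * m"
    using a m I0 by (simp add: a_def powr_diff)
  ultimately have "a powr r * m \<le> J" by (simp add: left_diff_distrib)
  then have "m powr (r - 1) * (a powr r * m) \<le> m powr (r - 1) * J"
    by (intro mult_left_mono) auto
  moreover have "m powr (r - 1) * (a powr r * m) = I powr r"
    using m I by (simp add: a_def powr_divide powr_diff)
  ultimately show ?thesis
    unfolding J(1) using J(2) by (simp add: ennreal_mult[symmetric] ennreal_leI)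
qed

lemma nn_integral_lborel_affine:
  fixes h :: "'a::euclidean_space \<Rightarrow> ennreal"
  assumes [measurable]: "h \<in> borel_measurable borel" and t: "0 < t"
  shows "(\<integral>\<^sup>+w. h (x + t *\<^sub>R w) \<partial>lborel) = ennreal (t powr (- real DIM('a))) * (\<integral>\<^sup>+y. h y \<partial>lborel)"
proof -
  have "(\<integral>\<^sup>+y. h y \<partial>lborel) = ennreal (t ^ DIM('a)) * (\<integral>\<^sup>+w. h (x + t *\<^sub>R w) \<partial>lborel)"
    using t by (subst lborel_affine[of t x])
      (simp_all add: nn_integral_density nn_integral_distr nn_integral_cmult)
  then have "ennreal (t powr (- real DIM('a))) * (\<integral>\<^sup>+y. h y \<partial>lborel)
      = ennreal (t powr (- real DIM('a)) * t ^ DIM('a)) * (\<integral>\<^sup>+w. h (x + t *\<^sub>R w) \<partial>lborel)"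
    using t by (simp add: ennreal_mult mult.assoc)
  also have "t powr (- real DIM('a)) * t ^ DIM('a) = 1"
    using t by (simp add: powr_minus powr_realpow)
  finally show ?thesis by simp
qed

text \<open>
  The gain of integrability from averaging at scale \<open>t\<close>. Jensen bounds the \<open>p\<close>-th power of the average by the
  average \<open>G\<close> of \<open>f powr p\<close>. On the other hand \<open>G\<close> is at most \<open>t powr (- N) * F\<close>, because the
  substitution \<open>y = x + t w\<close> has Jacobian \<open>t ^ N\<close>. The surplus \<open>r / p - 1\<close> of the exponent is spent on this uniform bound, and
  one factor \<open>G\<close>, whose integral over \<open>x\<close> is harmless, is kept.
\<close>
lemma scaled_average_gain:
  fixes f :: "'a::euclidean_space \<Rightarrow> real"
  assumes f[measurable]: "f \<in> borel_measurable borel" and nonneg: "\<And>y. 0 \<le> f y"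
    and A[measurable]: "A \<in> sets borel" and m: "emeasure lborel A = ennreal m" "0 < m"
    and F: "(\<integral>\<^sup>+y. ennreal (f y powr p) \<partial>lborel) = ennreal F" "0 \<le> F"
    and p: "1 \<le> p" "p \<le> r" and t: "0 < t"
    and S: "0 \<le> S" "ennreal S \<le> (\<integral>\<^sup>+w. ennreal (f (x + t *\<^sub>R w)) * indicator A w \<partial>lborel)"
  shows "ennreal (S powr r) \<le>
    ennreal (m powr ((p - 1) * (r / p)) * F powr (r / p - 1) * t powr (- real DIM('a) * (r / p - 1)))
      * (\<integral>\<^sup>+w. ennreal (f (x + t *\<^sub>R w) powr p) * indicator A w \<partial>lborel)"
proof -
  let ?M = "density lborel (indicator A)"
  let ?G = "\<integral>\<^sup>+w. ennreal (f (x + t *\<^sub>R w) powr p) * indicator A w \<partial>lborel"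
  have G_le: "?G \<le> ennreal (t powr (- real DIM('a)) * F)"
  proof -
    have "?G \<le> (\<integral>\<^sup>+w. ennreal (f (x + t *\<^sub>R w) powr p) \<partial>lborel)"
      by (intro nn_integral_mono) (auto simp: indicator_def)
    also have "\<dots> = ennreal (t powr (- real DIM('a))) * (\<integral>\<^sup>+y. ennreal (f y powr p) \<partial>lborel)"
      by (rule nn_integral_lborel_affine[OF _ t]) measurable
    finally show ?thesis using F by (simp add: ennreal_mult)
  qed
  then obtain g where g: "?G = ennreal g" "0 \<le> g"
    by (cases ?G rule: ennreal_cases) (auto simp: top_unique)
  have g_le: "g \<le> t powr (- real DIM('a)) * F"
    using G_le g F(2) by (subst (asm) g(1)) (simp add: ennreal_le_iff)
  have "ennreal (S powr p) \<le> ennreal (m powr (p - 1)) * (\<integral>\<^sup>+w. ennreal (f (x + t *\<^sub>R w) powr p) \<partial>?M)"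
  proof (rule power_mean_nn_integral)
    show "emeasure ?M (space ?M) = ennreal m" using m by (simp add: emeasure_density)
    show "ennreal S \<le> (\<integral>\<^sup>+w. ennreal (f (x + t *\<^sub>R w)) \<partial>?M)"
      using S by (simp add: nn_integral_density mult.commute)
  qed (use nonneg m p S in auto)
  also have "(\<integral>\<^sup>+w. ennreal (f (x + t *\<^sub>R w) powr p) \<partial>?M) = ennreal g"
    using g by (simp add: nn_integral_density mult.commute)
  finally have Sp: "S powr p \<le> m powr (p - 1) * g"
    using g by (simp add: ennreal_mult[symmetric] ennreal_le_iff)
  have rp: "1 \<le> r / p" using p by simp
  have "S powr r = (S powr p) powr (r / p)" using p by (simp add: powr_powr)
  also have "\<dots> \<le> (m powr (p - 1) * g) powr (r / p)" using Sp rp by (intro powr_mono2) auto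
  also have "\<dots> = m powr ((p - 1) * (r / p)) * (g powr (r / p - 1) * g)"
  proof (cases "g = 0")
    case False
    have "(m powr (p - 1) * g) powr (r / p) = m powr ((p - 1) * (r / p)) * g powr (r / p)"
      using g m by (simp add: powr_mult powr_powr)
    then show ?thesis using False g by (simp add: powr_diff)
  qed auto
  also have "\<dots> \<le> m powr ((p - 1) * (r / p)) * ((t powr (- real DIM('a)) * F) powr (r / p - 1) * g)"
    using g_le g rp by (intro mult_left_mono mult_right_mono powr_mono2) auto
  also have "(t powr (- real DIM('a)) * F) powr (r / p - 1)
      = F powr (r / p - 1) * t powr (- real DIM('a) * (r / p - 1))"
    using F t by (simp add: powr_mult powr_powr mult.commute)
  finally have "ennreal (S powr r) \<le> ennreal (m powr ((p - 1) * (r / p)) * F powr (r / p - 1)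
      * t powr (- real DIM('a) * (r / p - 1)) * g)"
    by (intro ennreal_leI) (simp add: mult.assoc)
  then show ?thesis using g by (simp add: ennreal_mult)
qed

text \<open>
  The fundamental theorem of calculus along a ray at whose far end \<open>\<phi>\<close> vanishes.
\<close>
lemma abs_le_line_integral:
  fixes \<phi> :: "'a::euclidean_space \<Rightarrow> real"
  assumes \<phi>: "C_k (Suc k) \<phi>" and T: "0 < T" and end_zero: "\<phi> (x + T *\<^sub>R w) = 0" and w: "norm w \<le> B"
  shows "ennreal \<bar>\<phi> x\<bar> \<le> ennreal B *
    (\<integral>\<^sup>+t. ennreal (norm (grad \<phi> (x + t *\<^sub>R w))) * indicator {0<..T} t \<partial>lborel)"
proof -
  have [measurable]: "grad \<phi> \<in> borel_measurable borel"
    by (rule borel_measurable_continuous_onI[OF continuous_on_grad[OF \<phi>]])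
  have "continuous_on UNIV (\<lambda>t. grad \<phi> (x + t *\<^sub>R w))"
    by (rule continuous_on_compose2[OF continuous_on_grad[OF \<phi>]]) (auto intro!: continuous_intros)
  from continuous_on_inner[OF this continuous_on_const]
  have cont: "isCont (\<lambda>t. grad \<phi> (x + t *\<^sub>R w) \<bullet> w) t" for t
    by (simp add: continuous_on_eq_continuous_at)
  have "has_bochner_integral lborel (\<lambda>t. grad \<phi> (x + t *\<^sub>R w) \<bullet> w * indicator {0..T} t)
      (\<phi> (x + T *\<^sub>R w) - \<phi> (x + 0 *\<^sub>R w))"
    using T line_derivative[OF \<phi>] cont
    by (intro has_bochner_integral_FTC_Icc_real) auto
  then have "ennreal \<bar>\<phi> x\<bar> \<le> (\<integral>\<^sup>+t. norm (grad \<phi> (x + t *\<^sub>R w) \<bullet> w * indicator {0..T} t) \<partial>lborel)"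
    using integral_norm_bound_ennreal[of lborel "\<lambda>t. grad \<phi> (x + t *\<^sub>R w) \<bullet> w * indicator {0..T} t"]
    by (simp add: has_bochner_integral_iff end_zero)
  also have "\<dots> \<le> (\<integral>\<^sup>+t. ennreal B * (ennreal (norm (grad \<phi> (x + t *\<^sub>R w))) * indicator {0<..T} t) \<partial>lborel)"
  proof (rule nn_integral_mono_AE)
    \<comment> \<open>the endpoint \<open>0\<close> is removed because the weight used later is \<open>0 powr - b = 0\<close> there\<close>
    have "AE t in lborel. t \<noteq> (0::real)" by (rule AE_lborel_singleton)
    then show "AE t in lborel. ennreal (norm (grad \<phi> (x + t *\<^sub>R w) \<bullet> w * indicator {0..T} t))
        \<le> ennreal B * (ennreal (norm (grad \<phi> (x + t *\<^sub>R w))) * indicator {0<..T} t)"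
    proof eventually_elim
      fix t :: real assume "t \<noteq> 0"
      have "\<bar>grad \<phi> (x + t *\<^sub>R w) \<bullet> w\<bar> \<le> norm (grad \<phi> (x + t *\<^sub>R w)) * norm w"
        by (rule Cauchy_Schwarz_ineq2)
      also have "\<dots> \<le> norm (grad \<phi> (x + t *\<^sub>R w)) * B" using w by (intro mult_left_mono) auto
      finally show "ennreal (norm (grad \<phi> (x + t *\<^sub>R w) \<bullet> w * indicator {0..T} t))
        \<le> ennreal B * (ennreal (norm (grad \<phi> (x + t *\<^sub>R w))) * indicator {0<..T} t)"
        using \<open>t \<noteq> 0\<close> order.trans[OF norm_ge_zero w]
        by (auto simp: indicator_def ennreal_mult[symmetric] mult.commute intro!: ennreal_leI)
    qed
  qed
  also have "\<dots> = ennreal B * (\<integral>\<^sup>+t. ennreal (norm (grad \<phi> (x + t *\<^sub>R w))) * indicator {0<..T} t \<partial>lborel)"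
    by (rule nn_integral_cmult) measurable
  finally show ?thesis .
qed

lemma nn_integral_powr_from_0:
  assumes "- 1 < b" "0 \<le> T"
  shows "(\<integral>\<^sup>+t. ennreal (t powr b) * indicator {0<..T} t \<partial>lborel) = ennreal (T powr (b + 1) / (b + 1))"
proof -
  have "(\<integral>\<^sup>+t. ennreal (t powr b * indicator {0..T} t) \<partial>lborel) = ennreal (T powr (b + 1) / (b + 1))"
  proof (rule nn_integral_has_integral_lborel)
    show "((\<lambda>t. t powr b * indicator {0..T} t) has_integral T powr (b + 1) / (b + 1)) UNIV"
      using has_integral_powr_from_0[OF assms]
      unfolding has_integral_restrict_UNIV[symmetric, of _ _ "{0..T}"]
      by (rule has_integral_eq[rotated]) (auto simp: indicator_def)
  qed auto
  also have "(\<integral>\<^sup>+t. ennreal (t powr b * indicator {0..T} t) \<partial>lborel)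
      = (\<integral>\<^sup>+t. ennreal (t powr b) * indicator {0<..T} t \<partial>lborel)"
    by (intro nn_integral_cong) (auto simp: indicator_def)
  finally show ?thesis .
qed

section \<open>The subcritical Sobolev inequality for test functions\<close>

text \<open>
  Averaging \<open>abs_le_line_integral\<close> over directions \<open>w\<close> in a ball \<open>A\<close> bounds \<open>|\<phi> x|\<close> by the integral over
  \<open>t\<close> in \<open>(0, T]\<close> of \<open>S x t\<close>, the integral of \<open>|grad \<phi> (x + t w)|\<close> over \<open>w\<close> in \<open>A\<close>. The \<open>r\<close>-th power is
  moved inside this integral by Jensen's inequality for the measure with density \<open>t powr - b\<close>; with
  \<open>scaled_average_gain\<close> and Tonelli's theorem what is left is the integral of \<open>t powr \<beta>\<close> over \<open>(0, T]\<close>.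
\<close>
theorem subcritical_sobolev_inequality:
  fixes \<Omega> :: "'a::euclidean_space set"
  assumes \<Omega>: "bounded \<Omega>" and p: "1 < p" "p < real DIM('a)"
    and r: "p \<le> r" "r < sobolev_conj DIM('a) p"
  obtains C where "0 \<le> C"
    and "\<And>\<phi>. \<phi> \<in> test_funs \<Omega> \<Longrightarrow> (\<integral>\<^sup>+x. ennreal (\<bar>\<phi> x\<bar> powr r) \<partial>lborel)
      \<le> ennreal (C * (LINT x|lborel. norm (grad \<phi> x) powr p) powr (r / p))"
proof -
  define N where "N = real DIM('a)"
  have r1: "1 < r" "1 \<le> r / p" using p r by auto
  obtain R where R: "0 < R" "\<And>x. x \<in> \<Omega> \<Longrightarrow> norm x \<le> R"
    using \<Omega> bounded_pos by blast
  define T where "T = 2 * R + 1"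
  have T: "0 < T" using R by (simp add: T_def)
  obtain e :: 'a where e: "e \<in> Basis" using nonempty_Basis by blast
  \<comment> \<open>the directions stay away from the origin, so that \<open>x + T w\<close> is outside \<Omega> for all of them\<close>
  define A where "A = ball (2 *\<^sub>R e) 1"
  have normA: "1 \<le> norm w" "norm w \<le> 3" if "w \<in> A" for w
    using that e norm_triangle_ineq3[of w "2 *\<^sub>R e"] by (auto simp: A_def dist_norm norm_minus_commute)
  have [measurable]: "A \<in> sets borel" by (simp add: A_def)
  define m where "m = measure lborel A"
  have m: "emeasure lborel A = ennreal m" "0 < m"
    using emeasure_bounded_finite[of A]
    by (auto simp: m_def A_def emeasure_eq_ennreal_measure content_ball_pos)
  \<comment> \<open>The weight \<open>t powr - b\<close> must have finite mass, which needs \<open>b < 1\<close>, and must leave an integrable power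
    \<open>t powr \<beta>\<close> at the end, which needs \<open>b > b0\<close>. There is room because \<open>r\<close> is subcritical.\<close>
  define b0 where "b0 = (N * (r / p - 1) - 1) / (r - 1)"
  define b where "b = (b0 + 1) / 2"
  have "N * (r / p - 1) - 1 < r - 1"
    using r p by (simp add: sobolev_conj_def N_def field_simps)
  then have "b0 < 1" using r1 by (simp add: b0_def)
  then have b: "b < 1" "b0 < b" by (simp_all add: b_def)
  define \<beta> where "\<beta> = b * (r - 1) - N * (r / p - 1)"
  have \<beta>: "-1 < \<beta>"
    using b(2) r1 by (simp add: b0_def \<beta>_def divide_less_eq)
  define \<mu> where "\<mu> = density lborel (\<lambda>t. ennreal (t powr - b) * indicator {0<..T} t)"
  define k where "k = T powr (1 - b) / (1 - b)"
  have \<mu>: "emeasure \<mu> (space \<mu>) = ennreal k" "0 < k"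
    using nn_integral_powr_from_0[of "- b" T] b T by (auto simp: \<mu>_def emeasure_density k_def)
  define K where "K = k powr (r - 1) * m powr ((p - 1) * (r / p))"
  define c where "c = T powr (\<beta> + 1) / (\<beta> + 1)"
  define C where "C = (3 / m) powr r * K * m * c"
  show thesis
  proof
    show "0 \<le> C" using m \<beta> by (simp add: C_def K_def c_def)
    fix \<phi> assume \<phi>: "\<phi> \<in> test_funs \<Omega>"
    note T\<phi> = test_funsD[OF \<phi>]
    define f where "f = (\<lambda>x. norm (grad \<phi> x))"
    have f_nonneg: "0 \<le> f x" for x by (simp add: f_def)
    have cont: "continuous_on UNIV (grad \<phi>)" by (rule continuous_on_grad[OF T\<phi>(1)])
    have [measurable]: "grad \<phi> \<in> borel_measurable borel" "\<phi> \<in> borel_measurable borel"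
      using borel_measurable_continuous_onI cont test_funs_continuous[OF \<phi>] by blast+
    have f_meas[measurable]: "f \<in> borel_measurable borel" unfolding f_def by measurable
    define F where "F = (LINT x|lborel. f x powr p)"
    have "continuous_on UNIV (\<lambda>x. f x powr p)"
      unfolding f_def using cont p by (intro continuous_on_powr' continuous_on_norm continuous_on_const) auto
    then have "integrable lborel (\<lambda>x. f x powr p)"
      by (rule integrable_continuous_compact_support[OF _ T\<phi>(2)]) (simp add: f_def grad_eq_0_outside)
    then have F: "(\<integral>\<^sup>+x. ennreal (f x powr p) \<partial>lborel) = ennreal F" "0 \<le> F"
      unfolding F_def by (subst nn_integral_eq_integral) auto
    obtain M where M: "\<And>x. f x \<le> M"
      using bounded_continuous_compact_support[OF cont T\<phi>(2) grad_eq_0_outside] f_def by metis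
    define S where "S = (\<lambda>x t. enn2real (\<integral>\<^sup>+w. ennreal (f (x + t *\<^sub>R w)) * indicator A w \<partial>lborel))"
    define G where "G = (\<lambda>x t. \<integral>\<^sup>+w. ennreal (f (x + t *\<^sub>R w) powr p) * indicator A w \<partial>lborel)"
    have S: "ennreal (S x t) = (\<integral>\<^sup>+w. ennreal (f (x + t *\<^sub>R w)) * indicator A w \<partial>lborel)" for x t
    proof -
      have "(\<integral>\<^sup>+w. ennreal (f (x + t *\<^sub>R w)) * indicator A w \<partial>lborel) \<le> (\<integral>\<^sup>+w. ennreal M * indicator A w \<partial>lborel)"
        by (intro nn_integral_mono mult_right_mono ennreal_leI M) auto
      also have "\<dots> = ennreal M * ennreal m" using m by (simp add: nn_integral_cmult_indicator)
      also have "\<dots> < top" by (simp add: ennreal_mult_less_top)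
      finally show ?thesis by (simp add: S_def)
    qed
    have S_nonneg: "0 \<le> S x t" for x t by (simp add: S_def)
    have S_meas[measurable]: "S x \<in> borel_measurable borel" for x
      unfolding S_def by measurable
    have G_meas[measurable]: "(\<lambda>(x, t). G x t) \<in> borel_measurable (borel \<Otimes>\<^sub>M borel)"
      unfolding G_def by measurable
    have G_meas'[measurable]: "G x \<in> borel_measurable borel" for x
      unfolding G_def by measurable
    have mean: "ennreal (\<bar>\<phi> x\<bar> * m / 3) \<le> (\<integral>\<^sup>+t. ennreal (t powr b * S x t) \<partial>\<mu>)" if x: "x \<in> \<Omega>" for x
    proof -
      have line: "ennreal \<bar>\<phi> x\<bar> \<le> ennreal 3 * (\<integral>\<^sup>+t. ennreal (f (x + t *\<^sub>R w)) * indicator {0<..T} t \<partial>lborel)"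
        if w: "w \<in> A" for w
        unfolding f_def
      proof (rule abs_le_line_integral[OF T\<phi>(1) T _ normA(2)[OF w]])
        have "T \<le> norm (T *\<^sub>R w)" using normA(1)[OF w] T by simp
        moreover have "norm (T *\<^sub>R w) \<le> norm (x + T *\<^sub>R w) + norm x"
          using norm_triangle_ineq4[of "x + T *\<^sub>R w" x] by simp
        ultimately have "\<not> norm (x + T *\<^sub>R w) \<le> R"
          using R(2)[OF x] T_def by simp
        then show "\<phi> (x + T *\<^sub>R w) = 0" using R(2) T\<phi>(3,4) by blast
      qed
      have "ennreal \<bar>\<phi> x\<bar> * ennreal m = (\<integral>\<^sup>+w. ennreal \<bar>\<phi> x\<bar> * indicator A w \<partial>lborel)"
        using m by (simp add: nn_integral_cmult_indicator)
      also have "\<dots> \<le> (\<integral>\<^sup>+w. ennreal 3 * (\<integral>\<^sup>+t. ennreal (f (x + t *\<^sub>R w)) * indicator {0<..T} t * indicator A w \<partial>lborel) \<partial>lborel)"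
        using line by (intro nn_integral_mono) (auto simp: indicator_def)
      also have "\<dots> = ennreal 3 * (\<integral>\<^sup>+w. (\<integral>\<^sup>+t. ennreal (f (x + t *\<^sub>R w)) * indicator {0<..T} t * indicator A w \<partial>lborel) \<partial>lborel)"
        by (rule nn_integral_cmult) measurable
      also have "(\<integral>\<^sup>+w. (\<integral>\<^sup>+t. ennreal (f (x + t *\<^sub>R w)) * indicator {0<..T} t * indicator A w \<partial>lborel) \<partial>lborel)
         = (\<integral>\<^sup>+t. (\<integral>\<^sup>+w. ennreal (f (x + t *\<^sub>R w)) * indicator {0<..T} t * indicator A w \<partial>lborel) \<partial>lborel)"
        by (rule lborel_pair.Fubini') measurable
      also have "\<dots> = (\<integral>\<^sup>+t. ennreal (S x t) * indicator {0<..T} t \<partial>lborel)"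
        unfolding S by (intro nn_integral_cong) (auto simp: indicator_def)
      also have "\<dots> = (\<integral>\<^sup>+t. ennreal (t powr b * S x t) \<partial>\<mu>)"
        unfolding \<mu>_def using S_nonneg
        by (subst nn_integral_density)
          (auto simp: indicator_def ennreal_mult[symmetric] powr_minus intro!: nn_integral_cong)
      finally have "ennreal (1 / 3) * (ennreal \<bar>\<phi> x\<bar> * ennreal m)
          \<le> ennreal (1 / 3) * (ennreal 3 * (\<integral>\<^sup>+t. ennreal (t powr b * S x t) \<partial>\<mu>))"
        by (rule mult_left_mono) simp
      also have "\<dots> = ennreal ((1 / 3) * 3) * (\<integral>\<^sup>+t. ennreal (t powr b * S x t) \<partial>\<mu>)"
        by (subst ennreal_mult) (auto simp: mult.assoc)
      finally show ?thesis using m by (simp add: ennreal_mult[symmetric])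
    qed
    let ?Q = "F powr (r / p - 1)"
    have pw: "ennreal (\<bar>\<phi> x\<bar> powr r) \<le> ennreal ((3 / m) powr r * K * ?Q) *
        (\<integral>\<^sup>+t. ennreal (t powr \<beta>) * indicator {0<..T} t * G x t \<partial>lborel)" for x
    proof (cases "x \<in> \<Omega>")
      case False
      then have "\<phi> x = 0" using T\<phi>(3,4) by blast
      then show ?thesis by simp
    next
      case True
      have "ennreal ((\<bar>\<phi> x\<bar> * m / 3) powr r) \<le> ennreal (k powr (r - 1)) * (\<integral>\<^sup>+t. ennreal ((t powr b * S x t) powr r) \<partial>\<mu>)"
        using mean[OF True] r1 m S_nonneg \<mu>
        by (intro power_mean_nn_integral) (auto simp: \<mu>_def)
      also have "(\<integral>\<^sup>+t. ennreal ((t powr b * S x t) powr r) \<partial>\<mu>)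
          = (\<integral>\<^sup>+t. ennreal (t powr (b * (r - 1))) * indicator {0<..T} t * ennreal (S x t powr r) \<partial>lborel)"
        unfolding \<mu>_def using S_nonneg
        by (subst nn_integral_density)
          (auto simp: indicator_def ennreal_mult[symmetric] powr_mult powr_powr powr_add[symmetric] algebra_simps
            intro!: nn_integral_cong)
      also have "\<dots> \<le> (\<integral>\<^sup>+t. ennreal (m powr ((p - 1) * (r / p)) * ?Q) *
          (ennreal (t powr \<beta>) * indicator {0<..T} t * G x t) \<partial>lborel)"
      proof (rule nn_integral_mono)
        fix t :: real
        show "ennreal (t powr (b * (r - 1))) * indicator {0<..T} t * ennreal (S x t powr r)
          \<le> ennreal (m powr ((p - 1) * (r / p)) * ?Q) * (ennreal (t powr \<beta>) * indicator {0<..T} t * G x t)"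
        proof (cases "0 < t \<and> t \<le> T")
          case True
          have "ennreal (S x t powr r) \<le> ennreal (m powr ((p - 1) * (r / p)) * ?Q * t powr (- N * (r / p - 1))) * G x t"
            unfolding G_def N_def
            by (rule scaled_average_gain[OF f_meas f_nonneg _ m F _ r(1)])
              (use True p S S_nonneg in auto)
          then have "ennreal (t powr (b * (r - 1))) * ennreal (S x t powr r) \<le> ennreal (t powr (b * (r - 1))) *
              (ennreal (m powr ((p - 1) * (r / p)) * ?Q * t powr (- N * (r / p - 1))) * G x t)"
            by (rule mult_left_mono) simp
          also have "\<dots> = ennreal (m powr ((p - 1) * (r / p)) * ?Q * (t powr (b * (r - 1)) * t powr (- N * (r / p - 1)))) * G x t"
            by (simp add: mult.assoc[symmetric] ennreal_mult[symmetric]) (simp add: ac_simps)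
          also have "t powr (b * (r - 1)) * t powr (- N * (r / p - 1)) = t powr \<beta>"
            by (simp add: \<beta>_def powr_add[symmetric])
          finally show ?thesis using True by (simp add: ennreal_mult mult.assoc)
        qed (auto simp: indicator_def)
      qed
      also have "\<dots> = ennreal (m powr ((p - 1) * (r / p)) * ?Q) *
          (\<integral>\<^sup>+t. ennreal (t powr \<beta>) * indicator {0<..T} t * G x t \<partial>lborel)"
        by (rule nn_integral_cmult) measurable
      finally have "ennreal ((\<bar>\<phi> x\<bar> * m / 3) powr r) \<le> ennreal (k powr (r - 1)) *
          (ennreal (m powr ((p - 1) * (r / p)) * ?Q) *
            (\<integral>\<^sup>+t. ennreal (t powr \<beta>) * indicator {0<..T} t * G x t \<partial>lborel))"
        by (simp add: mult_left_mono)
      then have "ennreal ((3 / m) powr r) * ennreal ((\<bar>\<phi> x\<bar> * m / 3) powr r) \<le> ennreal ((3 / m) powr r) *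
         (ennreal (k powr (r - 1)) * (ennreal (m powr ((p - 1) * (r / p)) * ?Q) *
          (\<integral>\<^sup>+t. ennreal (t powr \<beta>) * indicator {0<..T} t * G x t \<partial>lborel)))"
        by (rule mult_left_mono) simp
      moreover have "(3 / m) powr r * (\<bar>\<phi> x\<bar> * m / 3) powr r = \<bar>\<phi> x\<bar> powr r"
        using m by (simp add: powr_mult[symmetric])
      ultimately show ?thesis
        by (simp add: ennreal_mult[symmetric] mult.assoc[symmetric] K_def)
    qed
    have G_int: "(\<integral>\<^sup>+x. G x t \<partial>lborel) = ennreal (m * F)" for t
    proof -
      have "(\<integral>\<^sup>+x. G x t \<partial>lborel) = (\<integral>\<^sup>+w. (\<integral>\<^sup>+x. ennreal (f (x + t *\<^sub>R w) powr p) * indicator A w \<partial>lborel) \<partial>lborel)"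
        unfolding G_def by (rule lborel_pair.Fubini') measurable
      also have "\<dots> = (\<integral>\<^sup>+w. ennreal F * indicator A w \<partial>lborel)"
      proof (rule nn_integral_cong)
        fix w :: 'a
        have "(\<integral>\<^sup>+x. ennreal (f (t *\<^sub>R w + 1 *\<^sub>R x) powr p) \<partial>lborel) = ennreal F"
          using F(1) by (subst nn_integral_lborel_affine[where h = "\<lambda>y. ennreal (f y powr p)"]) auto
        then show "(\<integral>\<^sup>+x. ennreal (f (x + t *\<^sub>R w) powr p) * indicator A w \<partial>lborel) = ennreal F * indicator A w"
          by (simp add: nn_integral_multc add.commute)
      qed
      also have "\<dots> = ennreal F * ennreal m" using m by (simp add: nn_integral_cmult_indicator)
      finally show ?thesis using F m by (simp add: ennreal_mult mult.commute)
    qed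
    have "(\<integral>\<^sup>+x. ennreal (\<bar>\<phi> x\<bar> powr r) \<partial>lborel) \<le> (\<integral>\<^sup>+x. ennreal ((3 / m) powr r * K * ?Q) *
        (\<integral>\<^sup>+t. ennreal (t powr \<beta>) * indicator {0<..T} t * G x t \<partial>lborel) \<partial>lborel)"
      by (rule nn_integral_mono) (rule pw)
    also have "\<dots> = ennreal ((3 / m) powr r * K * ?Q) *
        (\<integral>\<^sup>+x. (\<integral>\<^sup>+t. ennreal (t powr \<beta>) * indicator {0<..T} t * G x t \<partial>lborel) \<partial>lborel)"
      by (rule nn_integral_cmult) measurable
    also have "(\<integral>\<^sup>+x. (\<integral>\<^sup>+t. ennreal (t powr \<beta>) * indicator {0<..T} t * G x t \<partial>lborel) \<partial>lborel)
        = (\<integral>\<^sup>+t. (\<integral>\<^sup>+x. ennreal (t powr \<beta>) * indicator {0<..T} t * G x t \<partial>lborel) \<partial>lborel)"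
      by (rule lborel_pair.Fubini') measurable
    also have "\<dots> = (\<integral>\<^sup>+t. ennreal (t powr \<beta>) * indicator {0<..T} t * ennreal (m * F) \<partial>lborel)"
      by (intro nn_integral_cong) (subst nn_integral_cmult, auto simp: G_int)
    also have "\<dots> = ennreal c * ennreal (m * F)"
      using nn_integral_powr_from_0[OF \<beta>, of T] T by (subst nn_integral_multc) (auto simp: c_def)
    also have "ennreal ((3 / m) powr r * K * ?Q) * (ennreal c * ennreal (m * F)) = ennreal (C * (?Q * F))"
      using F m \<beta> by (simp add: ennreal_mult[symmetric] C_def K_def c_def)
    also have "?Q * F = F powr (r / p)"
      using F(2) r1 by (cases "F = 0") (auto simp: powr_diff)
    finally show "(\<integral>\<^sup>+x. ennreal (\<bar>\<phi> x\<bar> powr r) \<partial>lborel)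
        \<le> ennreal (C * (LINT x|lborel. norm (grad \<phi> x) powr p) powr (r / p))"
      by (simp add: F_def f_def)
  qed
qed

section \<open>The subcritical embedding of the Sobolev space\<close>

lemma Lp_norm_powr:
  "Lp_norm s \<Omega> u powr p = (LINT x|lebesgue_on \<Omega>. norm (u x) powr s) powr (p / s)"
  by (simp add: Lp_norm_def powr_powr)

lemma norm_diff_powr_le:
  fixes a b :: "'b::real_normed_vector"
  assumes "0 \<le> p"
  shows "norm (a - b) powr p \<le> 2 powr p * (norm a powr p + norm b powr p)"
proof -
  have "norm (a - b) powr p \<le> (2 * max (norm a) (norm b)) powr p"
    using norm_triangle_ineq4[of a b] assms by (intro powr_mono2) auto
  also have "\<dots> = 2 powr p * max (norm a) (norm b) powr p" by (simp add: powr_mult)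
  also have "max (norm a) (norm b) powr p \<le> norm a powr p + norm b powr p"
    by (cases "norm a \<le> norm b") (auto simp: max_def)
  finally show ?thesis by (simp add: mult_left_mono)
qed

lemma Lp_space_diff:
  fixes u v :: "'a::euclidean_space \<Rightarrow> 'b::euclidean_space"
  assumes u: "u \<in> Lp_space p \<Omega>" and v: "v \<in> Lp_space p \<Omega>" and p: "0 \<le> p"
  shows "(\<lambda>x. u x - v x) \<in> Lp_space p \<Omega>"
proof -
  have [measurable]: "u \<in> borel_measurable (lebesgue_on \<Omega>)" "v \<in> borel_measurable (lebesgue_on \<Omega>)"
    using u v by (auto simp: Lp_space_def)
  have "integrable (lebesgue_on \<Omega>) (\<lambda>x. norm (u x - v x) powr p)"
  proof (rule Bochner_Integration.integrable_bound)
    show "integrable (lebesgue_on \<Omega>) (\<lambda>x. 2 powr p * (norm (u x) powr p + norm (v x) powr p))"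
      using u v by (auto simp: Lp_space_def)
  qed (use norm_diff_powr_le[OF p] in auto)
  then show ?thesis by (simp add: Lp_space_def)
qed

lemma Lp_space_AE_eq:
  fixes u v :: "'a::euclidean_space \<Rightarrow> 'b::euclidean_space"
  assumes v: "v \<in> Lp_space p \<Omega>" and u[measurable]: "u \<in> borel_measurable (lebesgue_on \<Omega>)"
    and ae: "AE x in lebesgue_on \<Omega>. u x = v x"
  shows "u \<in> Lp_space p \<Omega>"
    and "(LINT x|lebesgue_on \<Omega>. norm (u x) powr p) = (LINT x|lebesgue_on \<Omega>. norm (v x) powr p)"
proof -
  have [measurable]: "v \<in> borel_measurable (lebesgue_on \<Omega>)" using v by (auto simp: Lp_space_def)
  have *: "AE x in lebesgue_on \<Omega>. norm (v x) powr p = norm (u x) powr p"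
    using ae by eventually_elim simp
  show "(LINT x|lebesgue_on \<Omega>. norm (u x) powr p) = (LINT x|lebesgue_on \<Omega>. norm (v x) powr p)"
    by (rule integral_cong_AE[symmetric, OF _ _ *]) measurable
  have "integrable (lebesgue_on \<Omega>) (\<lambda>x. norm (u x) powr p)"
    by (rule integrable_cong_AE_imp[OF _ _ *]) (use v in \<open>auto simp: Lp_space_def\<close>)
  then show "u \<in> Lp_space p \<Omega>" by (simp add: Lp_space_def)
qed

text \<open>
  Measurability on each of countably many compact boxes covering \<open>\<Omega>\<close> suffices. It is needed because
  integrals of nonmeasurable functions are \<open>0\<close> by convention, so that the norm of a
  weak gradient could otherwise depend on the choice of representative.
\<close>
lemma loc_integrable_measurable:
  fixes u :: "'a::euclidean_space \<Rightarrow> 'b::euclidean_space"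
  assumes u: "loc_integrable \<Omega> u" and \<Omega>: "open \<Omega>"
  shows "u \<in> borel_measurable (lebesgue_on \<Omega>)"
proof -
  obtain D where D: "countable D" "\<And>X. X \<in> D \<Longrightarrow> X \<subseteq> \<Omega> \<and> (\<exists>c d. X = cbox c d)" "\<Union>D = \<Omega>"
    using open_countable_Union_open_cbox[OF \<Omega>] by (metis Pow_iff subsetD)
  show ?thesis
  proof (rule measurable_piecewise_restrict[OF D(1)])
    fix X assume "X \<in> D"
    then obtain c d where X: "X = cbox c d" "X \<subseteq> \<Omega>" using D(2) by blast
    then show "X \<inter> space (lebesgue_on \<Omega>) \<in> sets (lebesgue_on \<Omega>)"
      using \<Omega> by (simp add: sets_restrict_space_iff)
    have "restrict_space (lebesgue_on \<Omega>) X = lebesgue_on X"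
      using X \<Omega> by (subst restrict_restrict_space) (auto simp: Int_absorb1)
    then show "u \<in> borel_measurable (restrict_space (lebesgue_on \<Omega>) X)"
      using u X compact_cbox[of c d] by (auto simp: loc_integrable_def intro: borel_measurable_integrable)
  qed (use D(3) in auto)
qed

lemma has_weak_gradient_Lp:
  fixes \<Omega> :: "'a::euclidean_space set"
  assumes \<Omega>: "open \<Omega>" and g: "has_weak_gradient \<Omega> u g" "g \<in> Lp_space p \<Omega>"
  shows "weak_gradient \<Omega> u \<in> Lp_space p \<Omega>"
    and "(LINT x|lebesgue_on \<Omega>. norm (weak_gradient \<Omega> u x) powr p) = (LINT x|lebesgue_on \<Omega>. norm (g x) powr p)"
proof -
  have "weak_gradient \<Omega> u \<in> borel_measurable (lebesgue_on \<Omega>)"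
    using has_weak_gradient_weak_gradient[OF g(1)] loc_integrable_measurable[OF _ \<Omega>]
    by (auto simp: has_weak_gradient_def)
  from Lp_space_AE_eq[OF g(2) this weak_gradient_AE_eq[OF g(1) \<Omega>]]
  show "weak_gradient \<Omega> u \<in> Lp_space p \<Omega>"
    "(LINT x|lebesgue_on \<Omega>. norm (weak_gradient \<Omega> u x) powr p) = (LINT x|lebesgue_on \<Omega>. norm (g x) powr p)" .
qed

lemma W1p_weak_gradient:
  fixes \<Omega> :: "'a::euclidean_space set"
  assumes "open \<Omega>" "u \<in> W1p p \<Omega>"
  shows "has_weak_gradient \<Omega> u (weak_gradient \<Omega> u)" "weak_gradient \<Omega> u \<in> Lp_space p \<Omega>"
  using assms has_weak_gradient_Lp(1) has_weak_gradient_weak_gradient by (auto simp: W1p_def)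

lemma continuous_in_Lp_space:
  fixes f :: "'a::euclidean_space \<Rightarrow> 'b::euclidean_space"
  assumes f: "continuous_on UNIV f" and K: "compact K" "K \<subseteq> \<Omega>"
    and supp: "\<And>x. x \<notin> K \<Longrightarrow> f x = 0" and \<Omega>: "open \<Omega>" and p: "0 < p"
  shows "f \<in> Lp_space p \<Omega>"
    and "(LINT x|lebesgue_on \<Omega>. norm (f x) powr p) = (LINT x|lborel. norm (f x) powr p)"
proof -
  have cont: "continuous_on UNIV (\<lambda>x. norm (f x) powr p)"
    using f p by (intro continuous_on_powr' continuous_on_norm continuous_on_const) auto
  have "integrable lborel (\<lambda>x. norm (f x) powr p)"
    by (rule integrable_continuous_compact_support[OF cont K(1)]) (simp add: supp)
  moreover have "norm (f x) powr p = 0" if "x \<notin> \<Omega>" for x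
    using that K(2) supp[of x] by auto
  note eq = integral_lebesgue_on_eq_lborel[OF borel_measurable_continuous_onI[OF cont] this]
  show "(LINT x|lebesgue_on \<Omega>. norm (f x) powr p) = (LINT x|lborel. norm (f x) powr p)"
    using eq(1) \<Omega> by simp
  have "f \<in> borel_measurable (lebesgue_on \<Omega>)"
    using borel_measurable_continuous_onI[OF f]
    by (intro measurable_restrict_space1 measurable_completion) simp
  ultimately show "f \<in> Lp_space p \<Omega>"
    using eq(2) \<Omega> by (simp add: Lp_space_def)
qed

lemma test_fun_Lp_space:
  fixes \<Omega> :: "'a::euclidean_space set"
  assumes \<phi>: "\<phi> \<in> test_funs \<Omega>" and \<Omega>: "open \<Omega>" and p: "0 < p"
  shows "\<phi> \<in> Lp_space p \<Omega>" and "grad \<phi> \<in> Lp_space p \<Omega>"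
    and "(LINT x|lebesgue_on \<Omega>. norm (grad \<phi> x) powr p) = (LINT x|lborel. norm (grad \<phi> x) powr p)"
proof -
  note T = test_funsD[OF \<phi>]
  show "\<phi> \<in> Lp_space p \<Omega>"
    by (rule continuous_in_Lp_space(1)[OF test_funs_continuous[OF \<phi>] T(2,3,4) \<Omega> p])
  show "grad \<phi> \<in> Lp_space p \<Omega>"
    by (rule continuous_in_Lp_space(1)[OF continuous_on_grad[OF T(1)] T(2,3) grad_eq_0_outside \<Omega> p])
  show "(LINT x|lebesgue_on \<Omega>. norm (grad \<phi> x) powr p) = (LINT x|lborel. norm (grad \<phi> x) powr p)"
    by (rule continuous_in_Lp_space(2)[OF continuous_on_grad[OF T(1)] T(2,3) grad_eq_0_outside \<Omega> p])
qed

lemma W1p_norm_powr: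
  assumes "0 < p"
  shows "W1p_norm p \<Omega> u powr p = (LINT x|lebesgue_on \<Omega>. norm (u x) powr p)
    + (LINT x|lebesgue_on \<Omega>. norm (weak_gradient \<Omega> u x) powr p)"
  using assms by (simp add: W1p_norm_def Lp_norm_def powr_powr)

lemma test_funs_subset_W1p_0:
  fixes \<Omega> :: "'a::euclidean_space set"
  assumes \<Omega>: "open \<Omega>" and p: "1 < p" and \<phi>: "\<phi> \<in> test_funs \<Omega>"
  shows "\<phi> \<in> W1p_0 p \<Omega>"
proof -
  have p0: "0 < p" using p by simp
  note G = has_weak_gradient_grad[OF \<Omega> \<phi>]
  note L = test_fun_Lp_space[OF \<phi> \<Omega> p0]
  have "W1p_norm p \<Omega> (\<lambda>x. \<phi> x - \<phi> x) powr p = 0"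
    unfolding W1p_norm_powr[OF p0]
    using has_weak_gradient_Lp(2)[OF \<Omega> has_weak_gradient_diff[OF G G \<Omega>] Lp_space_diff[OF L(2,2)]] p0
    by simp
  then have "W1p_norm p \<Omega> (\<lambda>x. \<phi> x - \<phi> x) = 0" by simp
  then have "\<exists>\<psi>\<in>test_funs \<Omega>. W1p_norm p \<Omega> (\<lambda>x. \<phi> x - \<psi> x) < \<epsilon>" if "\<epsilon> > 0" for \<epsilon>
    using that by (intro bexI[OF _ \<phi>]) simp
  then show ?thesis
    using L(1,2) G by (auto simp: W1p_0_def W1p_def)
qed

text \<open>
  This makes the set whose infimum defines \<open>sobolev_lambda\<close> nonempty; the witness is a smooth cutoff.
\<close>
lemma ex_nonzero_W1p_0:
  fixes \<Omega> :: "'a::euclidean_space set"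
  assumes \<Omega>: "open \<Omega>" "\<Omega> \<noteq> {}" and p: "1 < p"
  obtains u where "u \<in> W1p_0 p \<Omega>" "\<not> (AE x in lebesgue_on \<Omega>. u x = 0)"
proof -
  obtain x where x: "x \<in> \<Omega>" using \<Omega> by blast
  obtain a b where ab: "x \<in> box a b" "cbox a b \<subseteq> \<Omega>"
    by (rule open_contains_cbox[OF \<Omega>(1) x])
  show ?thesis
  proof
    show "box_cutoff a b 1 \<in> W1p_0 p \<Omega>"
      by (rule test_funs_subset_W1p_0[OF \<Omega>(1) p smooth_cutoff(1)[OF ab(2)]])
    show "\<not> (AE x in lebesgue_on \<Omega>. box_cutoff a b 1 x = 0)"
    proof
      assume "AE x in lebesgue_on \<Omega>. box_cutoff a b 1 x = 0"
      then have "AE x in lebesgue. x \<in> \<Omega> \<longrightarrow> box_cutoff a b 1 x = 0"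
        using \<Omega> by (subst (asm) AE_restrict_space_iff) auto
      then have "AE x in lebesgue. x \<notin> box a b"
      proof eventually_elim
        case (elim x)
        then show ?case
          using smooth_cutoff(5)[OF ab(2), of x 0] box_subset_cbox[of a b] ab(2) by auto
      qed
      then have "box a b \<in> null_sets lebesgue"
        by (subst (asm) AE_iff_null_sets[symmetric]) auto
      then have "negligible (box a b)" by (simp add: negligible_iff_null_sets)
      then show False using open_not_negligible[OF open_box, of a b] ab(1) by blast
    qed
  qed
qed

text \<open>
  Approximate \<open>u\<close> by test functions; a subsequence converges almost everywhere, so Fatou's lemma transfers the
  bound. The factor \<open>2 powr r\<close> comes from the crude estimate of the energies of the approximants by
  \<open>norm_diff_powr_le\<close>; only the finiteness of the constant matters.
\<close>
theorem W1p_0_subcritical_embedding: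
  fixes \<Omega> :: "'a::euclidean_space set"
  assumes \<Omega>: "open \<Omega>" "bounded \<Omega>" and p: "1 < p" "p < real DIM('a)"
    and r: "p \<le> r" "r < sobolev_conj DIM('a) p"
  obtains C where "0 \<le> C"
    and "\<And>u. u \<in> W1p_0 p \<Omega> \<Longrightarrow> (\<integral>\<^sup>+x. ennreal (\<bar>u x\<bar> powr r) \<partial>lebesgue_on \<Omega>)
      \<le> ennreal (C * (LINT x|lebesgue_on \<Omega>. norm (weak_gradient \<Omega> u x) powr p) powr (r / p))"
proof -
  obtain C where C: "0 \<le> C" "\<And>\<phi>. \<phi> \<in> test_funs \<Omega> \<Longrightarrow> (\<integral>\<^sup>+x. ennreal (\<bar>\<phi> x\<bar> powr r) \<partial>lborel)
      \<le> ennreal (C * (LINT x|lborel. norm (grad \<phi> x) powr p) powr (r / p))"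
    using subcritical_sobolev_inequality[OF \<Omega>(2) p r] by blast
  have p0: "0 < p" "1 \<le> r / p" "0 < r" using p r by auto
  show thesis
  proof
    show "0 \<le> C * 2 powr r" using C by simp
    fix u assume u: "u \<in> W1p_0 p \<Omega>"
    then have uW: "u \<in> W1p p \<Omega>" and uL: "u \<in> Lp_space p \<Omega>" by (auto simp: W1p_0_def W1p_def)
    define G where "G = weak_gradient \<Omega> u"
    note G = W1p_weak_gradient[OF \<Omega>(1) uW, folded G_def]
    define E where "E = (LINT x|lebesgue_on \<Omega>. norm (G x) powr p)"
    define \<delta> where "\<delta> = (\<lambda>k. inverse (real (Suc k)) powr p)"
    have \<delta>: "\<delta> \<longlonglongrightarrow> 0"
      using tendsto_powr'[OF LIMSEQ_inverse_real_of_nat tendsto_const[of p]] p0 by (simp add: \<delta>_def)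
    have "\<exists>\<phi>\<in>test_funs \<Omega>. W1p_norm p \<Omega> (\<lambda>x. u x - \<phi> x) < inverse (real (Suc k))" for k
      using u by (simp add: W1p_0_def del: of_nat_Suc)
    then obtain \<phi> where \<phi>: "\<And>k. \<phi> k \<in> test_funs \<Omega>"
      and close: "\<And>k. W1p_norm p \<Omega> (\<lambda>x. u x - \<phi> k x) < inverse (real (Suc k))" by metis
    note L = test_fun_Lp_space[OF \<phi> \<Omega>(1) p0(1)]
    have near: "(LINT x|lebesgue_on \<Omega>. norm (u x - \<phi> k x) powr p) \<le> \<delta> k"
      "(LINT x|lebesgue_on \<Omega>. norm (G x - grad (\<phi> k) x) powr p) \<le> \<delta> k" for k
    proof -
      have "W1p_norm p \<Omega> (\<lambda>x. u x - \<phi> k x) powr p \<le> \<delta> k"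
        unfolding \<delta>_def using close[of k] p0 by (intro powr_mono2) (auto simp: W1p_norm_def)
      moreover have "(LINT x|lebesgue_on \<Omega>. norm (weak_gradient \<Omega> (\<lambda>x. u x - \<phi> k x) x) powr p)
          = (LINT x|lebesgue_on \<Omega>. norm (G x - grad (\<phi> k) x) powr p)"
        using has_weak_gradient_diff[OF G(1) has_weak_gradient_grad[OF \<Omega>(1) \<phi>] \<Omega>(1)]
          Lp_space_diff[OF G(2) L(2)] p0 by (intro has_weak_gradient_Lp(2)[OF \<Omega>(1)]) auto
      moreover have "0 \<le> (LINT x|lebesgue_on \<Omega>. norm (u x - \<phi> k x) powr p)"
        "0 \<le> (LINT x|lebesgue_on \<Omega>. norm (G x - grad (\<phi> k) x) powr p)"
        by (auto intro!: integral_nonneg_AE)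
      ultimately show "(LINT x|lebesgue_on \<Omega>. norm (u x - \<phi> k x) powr p) \<le> \<delta> k"
        "(LINT x|lebesgue_on \<Omega>. norm (G x - grad (\<phi> k) x) powr p) \<le> \<delta> k"
        unfolding W1p_norm_powr[OF p0(1)] by linarith+
    qed
    have Lu: "integrable (lebesgue_on \<Omega>) (\<lambda>x. norm (u x - \<phi> k x) powr p)" for k
      using Lp_space_diff[OF uL L(1)] p0 by (simp add: Lp_space_def)
    have energy: "(LINT x|lborel. norm (grad (\<phi> k) x) powr p) \<le> 2 powr p * (E + \<delta> k)" for k
    proof -
      have i: "integrable (lebesgue_on \<Omega>) (\<lambda>x. norm (G x) powr p)"
        "integrable (lebesgue_on \<Omega>) (\<lambda>x. norm (G x - grad (\<phi> k) x) powr p)"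
        "integrable (lebesgue_on \<Omega>) (\<lambda>x. norm (grad (\<phi> k) x) powr p)"
        using G(2) Lp_space_diff[OF G(2) L(2)] L(2) p0 by (auto simp: Lp_space_def)
      have "(LINT x|lborel. norm (grad (\<phi> k) x) powr p) = (LINT x|lebesgue_on \<Omega>. norm (grad (\<phi> k) x) powr p)"
        by (rule L(3)[symmetric])
      also have "\<dots> \<le> (LINT x|lebesgue_on \<Omega>. 2 powr p * (norm (G x) powr p + norm (G x - grad (\<phi> k) x) powr p))"
      proof (rule integral_mono)
        fix x
        show "norm (grad (\<phi> k) x) powr p \<le> 2 powr p * (norm (G x) powr p + norm (G x - grad (\<phi> k) x) powr p)"
          using norm_diff_powr_le[of p "G x" "G x - grad (\<phi> k) x"] p0 by simp
      qed (use i in auto)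
      also have "\<dots> = 2 powr p * (E + (LINT x|lebesgue_on \<Omega>. norm (G x - grad (\<phi> k) x) powr p))"
        using i by (simp add: E_def)
      also have "\<dots> \<le> 2 powr p * (E + \<delta> k)" using near(2)[of k] by simp
      finally show ?thesis .
    qed
    have bound: "(\<integral>\<^sup>+x. ennreal (\<bar>\<phi> k x\<bar> powr r) \<partial>lebesgue_on \<Omega>)
        \<le> ennreal (C * (2 powr p * (E + \<delta> k)) powr (r / p))" for k
    proof -
      have [measurable]: "\<phi> k \<in> borel_measurable borel"
        by (rule borel_measurable_continuous_onI[OF test_funs_continuous[OF \<phi>]])
      have "(\<integral>\<^sup>+x. ennreal (\<bar>\<phi> k x\<bar> powr r) \<partial>lebesgue_on \<Omega>)
          = (\<integral>\<^sup>+x. ennreal (\<bar>\<phi> k x\<bar> powr r) * indicator \<Omega> x \<partial>lebesgue)"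
        using \<Omega> by (intro nn_integral_restrict_space) auto
      also have "\<dots> \<le> (\<integral>\<^sup>+x. ennreal (\<bar>\<phi> k x\<bar> powr r) \<partial>lebesgue)"
        by (intro nn_integral_mono) (auto simp: indicator_def)
      also have "\<dots> = (\<integral>\<^sup>+x. ennreal (\<bar>\<phi> k x\<bar> powr r) \<partial>lborel)"
        by (rule nn_integral_completion)
      also have "\<dots> \<le> ennreal (C * (LINT x|lborel. norm (grad (\<phi> k) x) powr p) powr (r / p))"
        by (rule C(2)[OF \<phi>])
      also have "\<dots> \<le> ennreal (C * (2 powr p * (E + \<delta> k)) powr (r / p))"
        using C(1) energy[of k] p0 by (intro ennreal_leI mult_left_mono powr_mono2 integral_nonneg_AE) auto
      finally show ?thesis .
    qed
    have "(\<lambda>k. LINT x|lebesgue_on \<Omega>. norm (norm (u x - \<phi> k x) powr p)) \<longlonglongrightarrow> 0"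
      using near(1) by (intro tendsto_sandwich[OF _ _ tendsto_const \<delta>]) (auto intro!: always_eventually integral_nonneg_AE)
    then obtain s :: "nat \<Rightarrow> nat" where s: "strict_mono s"
      and ae: "AE x in lebesgue_on \<Omega>. (\<lambda>k. norm (u x - \<phi> (s k) x) powr p) \<longlonglongrightarrow> 0"
      using tendsto_L1_AE_subseq[of "lebesgue_on \<Omega>" "\<lambda>k x. norm (u x - \<phi> k x) powr p", OF Lu] by blast
    have lim: "AE x in lebesgue_on \<Omega>. (\<lambda>k. \<bar>\<phi> (s k) x\<bar> powr r) \<longlonglongrightarrow> \<bar>u x\<bar> powr r"
      using ae
    proof eventually_elim
      case (elim x)
      have "(\<lambda>k. (norm (u x - \<phi> (s k) x) powr p) powr (1 / p)) \<longlonglongrightarrow> 0 powr (1 / p)"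
        using elim p0 by (intro tendsto_powr') auto
      then have "(\<lambda>k. \<bar>u x - \<phi> (s k) x\<bar>) \<longlonglongrightarrow> 0"
        using p0 by (simp add: powr_powr)
      then have "(\<lambda>k. u x - (u x - \<phi> (s k) x)) \<longlonglongrightarrow> u x - 0"
        by (intro tendsto_diff tendsto_const) (simp add: tendsto_rabs_zero_iff)
      then show ?case using p0 by (intro tendsto_powr') (auto intro!: tendsto_rabs)
    qed
    have [measurable]: "\<phi> k \<in> borel_measurable (lebesgue_on \<Omega>)" for k
      using L(1) by (auto simp: Lp_space_def)
    have "(\<integral>\<^sup>+x. ennreal (\<bar>u x\<bar> powr r) \<partial>lebesgue_on \<Omega>)
        = (\<integral>\<^sup>+x. liminf (\<lambda>k. ennreal (\<bar>\<phi> (s k) x\<bar> powr r)) \<partial>lebesgue_on \<Omega>)"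
    proof (rule nn_integral_cong_AE)
      show "AE x in lebesgue_on \<Omega>. ennreal (\<bar>u x\<bar> powr r) = liminf (\<lambda>k. ennreal (\<bar>\<phi> (s k) x\<bar> powr r))"
        using lim
      proof eventually_elim
        case (elim x)
        then have "(\<lambda>k. ennreal (\<bar>\<phi> (s k) x\<bar> powr r)) \<longlonglongrightarrow> ennreal (\<bar>u x\<bar> powr r)" by (rule tendsto_ennrealI)
        from lim_imp_Liminf[OF trivial_limit_sequentially this] show ?case by (rule sym)
      qed
    qed
    also have "\<dots> \<le> liminf (\<lambda>k. \<integral>\<^sup>+x. ennreal (\<bar>\<phi> (s k) x\<bar> powr r) \<partial>lebesgue_on \<Omega>)"
      by (rule nn_integral_liminf) measurable
    also have "\<dots> \<le> liminf (\<lambda>k. ennreal (C * (2 powr p * (E + \<delta> (s k))) powr (r / p)))"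
      by (intro Liminf_mono always_eventually allI bound)
    also have "\<dots> = ennreal (C * (2 powr p * (E + 0)) powr (r / p))"
    proof (rule lim_imp_Liminf)
      have "(\<lambda>k. \<delta> (s k)) \<longlonglongrightarrow> 0"
        using LIMSEQ_subseq_LIMSEQ[OF \<delta> s] by (simp add: o_def)
      moreover have "0 \<le> E" by (auto simp: E_def intro!: integral_nonneg_AE)
      ultimately show "(\<lambda>k. ennreal (C * (2 powr p * (E + \<delta> (s k))) powr (r / p)))
          \<longlonglongrightarrow> ennreal (C * (2 powr p * (E + 0)) powr (r / p))"
        using p0 by (intro tendsto_ennrealI tendsto_mult tendsto_const tendsto_powr' tendsto_add)
          (auto simp: \<delta>_def)
    qed simp
    also have "(2 powr p * (E + 0)) powr (r / p) = 2 powr r * E powr (r / p)"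
      using p0 by (simp add: powr_mult powr_powr)
    finally show "(\<integral>\<^sup>+x. ennreal (\<bar>u x\<bar> powr r) \<partial>lebesgue_on \<Omega>)
        \<le> ennreal (C * 2 powr r * (LINT x|lebesgue_on \<Omega>. norm (weak_gradient \<Omega> u x) powr p) powr (r / p))"
      by (simp add: E_def G_def mult.assoc)
  qed
qed

section \<open>Dependence of the best constants on the exponent\<close>

text \<open>
  For \<open>y \<le> 1\<close> the left-hand side is not positive. For \<open>y > 1\<close> it is at most \<open>(s - q) * ln y * y powr s\<close>, and the
  logarithm is absorbed by \<open>z \<le> exp z\<close> with \<open>z = (r - s) * ln y\<close>.
\<close>
lemma powr_diff_le:
  fixes y :: real
  assumes y: "0 \<le> y" and qsr: "0 < q" "q \<le> s" "s < r"
  shows "y powr s - y powr q \<le> (s - q) / (r - s) * y powr r"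
proof (cases "y \<le> 1")
  case True
  have "y powr s \<le> y powr q"
    using y True qsr by (cases "y = 0") (auto intro: powr_mono')
  then show ?thesis using qsr by (auto intro: order.trans[of _ 0])
next
  case False
  then have ln: "0 < ln y" by simp
  have "y powr s - y powr q = y powr s * (1 - exp (- ((s - q) * ln y)))"
    using False by (simp add: powr_def right_diff_distrib exp_add[symmetric] left_diff_distrib)
  also have "\<dots> \<le> y powr s * ((s - q) * ln y)"
    using exp_ge_add_one_self[of "- ((s - q) * ln y)"] by (intro mult_left_mono) auto
  also have "\<dots> = y powr s * ((s - q) / (r - s) * ((r - s) * ln y))"
    using qsr by simp
  also have "(r - s) * ln y \<le> y powr (r - s)"
  proof -
    have "(r - s) * ln y \<le> exp ((r - s) * ln y)"
      using exp_ge_add_one_self[of "(r - s) * ln y"] by linarith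
    then show ?thesis using False by (simp add: powr_def)
  qed
  then have "y powr s * ((s - q) / (r - s) * ((r - s) * ln y)) \<le> y powr s * ((s - q) / (r - s) * y powr (r - s))"
    using qsr by (intro mult_left_mono) auto
  also have "\<dots> = (s - q) / (r - s) * y powr r"
    by (simp add: powr_diff)
  finally show ?thesis .
qed

lemma integrable_powr_less:
  fixes u :: "'a \<Rightarrow> real"
  assumes fin: "finite_measure M" and u[measurable]: "u \<in> borel_measurable M"
    and ur: "integrable M (\<lambda>x. \<bar>u x\<bar> powr r)" and t: "0 < t" "t \<le> r"
  shows "integrable M (\<lambda>x. \<bar>u x\<bar> powr t)"
proof (rule Bochner_Integration.integrable_bound)
  interpret finite_measure M by fact
  show "integrable M (\<lambda>x. 1 + \<bar>u x\<bar> powr r)" using ur by simp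
  show "AE x in M. norm (\<bar>u x\<bar> powr t) \<le> norm (1 + \<bar>u x\<bar> powr r)"
  proof (rule AE_I2)
    fix x
    show "norm (\<bar>u x\<bar> powr t) \<le> norm (1 + \<bar>u x\<bar> powr r)"
    proof (cases "\<bar>u x\<bar> \<le> 1")
      case True
      then have "\<bar>u x\<bar> powr t \<le> 1" using powr_mono2[of t "\<bar>u x\<bar>" 1] t by simp
      then show ?thesis by (simp add: add_increasing2)
    next
      case False
      then have "\<bar>u x\<bar> powr t \<le> \<bar>u x\<bar> powr r" using t by (intro powr_mono) auto
      then show ?thesis by simp
    qed
  qed
qed measurable

text \<open>
  The number \<open>a\<close> is the normalised mean of order \<open>s\<close>, so \<open>|u| / a\<close> has mean \<open>1\<close> in that order. The first claim is
  the monotonicity of means in the exponent; the second is \<open>powr_diff_le\<close> integrated, a quantitative converse.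
\<close>
lemma power_integrals_compare:
  fixes u :: "'a \<Rightarrow> real"
  assumes fin: "finite_measure M" and V: "measure M (space M) = V" "0 < V"
    and u[measurable]: "u \<in> borel_measurable M" and ur: "integrable M (\<lambda>x. \<bar>u x\<bar> powr r)"
    and qsr: "0 < q" "q \<le> s" "s < r" and a: "a = ((LINT x|M. \<bar>u x\<bar> powr s) / V) powr (1 / s)"
    and pos: "0 < (LINT x|M. \<bar>u x\<bar> powr s)"
  shows "(LINT x|M. \<bar>u x\<bar> powr q) / (V * a powr q) \<le> 1"
    and "1 - (s - q) / (r - s) * ((LINT x|M. \<bar>u x\<bar> powr r) / (V * a powr r))
      \<le> (LINT x|M. \<bar>u x\<bar> powr q) / (V * a powr q)"
proof -
  interpret finite_measure M by fact
  have a0: "0 < a" using pos V by (simp add: a)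
  have int: "integrable M (\<lambda>x. \<bar>u x\<bar> powr t)" if "0 < t" "t \<le> r" for t
    by (rule integrable_powr_less[OF fin u ur that])
  define J where "J = (\<lambda>t. (LINT x|M. (\<bar>u x\<bar> / a) powr t))"
  have J: "integrable M (\<lambda>x. (\<bar>u x\<bar> / a) powr t)" "J t = (LINT x|M. \<bar>u x\<bar> powr t) / a powr t"
    if "0 < t" "t \<le> r" for t
    using int[OF that] a0 by (simp_all add: J_def powr_divide)
  have Js: "J s = V"
  proof -
    have "a powr s = (LINT x|M. \<bar>u x\<bar> powr s) / V"
      using pos V qsr by (simp add: a powr_powr)
    then show ?thesis using J(2)[of s] pos qsr by simp
  qed
  have "(LINT x|M. s / q * (\<bar>u x\<bar> / a) powr q) \<le> (LINT x|M. (\<bar>u x\<bar> / a) powr s + (s / q - 1))"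
  proof (rule integral_mono)
    fix x
    show "s / q * (\<bar>u x\<bar> / a) powr q \<le> (\<bar>u x\<bar> / a) powr s + (s / q - 1)"
      using bernoulli_powr[of "(\<bar>u x\<bar> / a) powr q" "s / q"] qsr by (simp add: powr_powr)
  qed (use J(1)[of q] J(1)[of s] qsr in auto)
  then have "s / q * J q \<le> V + V * (s / q - 1)"
    using J(1)[of s] qsr Js by (simp add: J_def V)
  then have "s / q * J q \<le> s / q * V" by (simp add: algebra_simps)
  then have "J q \<le> V" using qsr by (subst (asm) mult_le_cancel_left_pos) auto
  then show "(LINT x|M. \<bar>u x\<bar> powr q) / (V * a powr q) \<le> 1"
    using J(2)[of q] qsr V a0 by (simp add: field_simps)
  have "(LINT x|M. (\<bar>u x\<bar> / a) powr s - (\<bar>u x\<bar> / a) powr q)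
      \<le> (LINT x|M. (s - q) / (r - s) * (\<bar>u x\<bar> / a) powr r)"
    using J(1)[of s] J(1)[of q] J(1)[of r] qsr a0
    by (intro integral_mono powr_diff_le) auto
  then have "V - J q \<le> (s - q) / (r - s) * J r"
    using J(1)[of s] J(1)[of q] qsr Js by (simp add: J_def)
  then have "(V - J q) / V \<le> ((s - q) / (r - s) * J r) / V"
    using V by (intro divide_right_mono) auto
  then have "1 - J q / V \<le> (s - q) / (r - s) * (J r / V)"
    using V by (simp add: diff_divide_distrib)
  then show "1 - (s - q) / (r - s) * ((LINT x|M. \<bar>u x\<bar> powr r) / (V * a powr r))
      \<le> (LINT x|M. \<bar>u x\<bar> powr q) / (V * a powr q)"
    using J(2)[of q] J(2)[of r] qsr by (simp add: mult.commute)
qed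

text \<open>
  The assumption \<open>growth\<close> controls \<open>\<rho> q u\<close> by \<open>\<rho> s u\<close> with a constant depending on \<open>\<rho> s u\<close> itself. It is
  applied only to near-minimisers of \<open>\<rho> s\<close>, where by monotonicity \<open>\<rho> s u\<close> exceeds the infimum of \<open>\<rho> 1\<close> by at
  most \<open>1\<close>. It degenerates as \<open>y\<close> approaches \<open>1\<close>, that is for exponents far apart; there it is enough that all
  the infima lie between \<open>0\<close> and that of \<open>\<rho> 1\<close>.
\<close>
lemma infima_lipschitz:
  fixes \<rho> :: "real \<Rightarrow> 'u \<Rightarrow> real"
  assumes U: "U \<noteq> {}" and nonneg: "\<And>q u. u \<in> U \<Longrightarrow> 0 \<le> \<rho> q u" and p: "0 \<le> p" and e: "0 \<le> e" and D: "0 \<le> D"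
    and mono: "\<And>q s u. u \<in> U \<Longrightarrow> 1 \<le> q \<Longrightarrow> q \<le> s \<Longrightarrow> s \<le> b \<Longrightarrow> \<rho> s u \<le> \<rho> q u"
    and growth: "\<And>q s u y. u \<in> U \<Longrightarrow> 1 \<le> q \<Longrightarrow> q \<le> s \<Longrightarrow> s \<le> b \<Longrightarrow>
      D * \<rho> s u powr e * (s - q) \<le> y \<Longrightarrow> y < 1 \<Longrightarrow> \<rho> q u \<le> \<rho> s u * (1 - y) powr (- p)"
  shows "\<exists>L>0. \<forall>s\<in>{1..b}. \<forall>q\<in>{1..b}. \<bar>(INF u\<in>U. \<rho> s u) - (INF u\<in>U. \<rho> q u)\<bar> \<le> L * \<bar>s - q\<bar>"
proof -
  define \<Lambda> where "\<Lambda> = (\<lambda>q. INF u\<in>U. \<rho> q u)"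
  have bdd: "bdd_below (\<rho> q ` U)" for q using nonneg by (auto intro!: bdd_belowI)
  have lower: "\<Lambda> q \<le> \<rho> q u" if "u \<in> U" for q u
    unfolding \<Lambda>_def by (rule cINF_lower[OF bdd that])
  have \<Lambda>_nonneg: "0 \<le> \<Lambda> q" for q unfolding \<Lambda>_def using U nonneg by (intro cINF_greatest) auto
  have anti: "\<Lambda> s \<le> \<Lambda> q" if "1 \<le> q" "q \<le> s" "s \<le> b" for q s
    unfolding \<Lambda>_def by (rule cINF_mono[OF U bdd]) (use mono that in blast)
  define K where "K = D * (\<Lambda> 1 + 1) powr e"
  have K: "0 \<le> K" using D by (simp add: K_def)
  define c where "c = 2 * p * exp p"
  have c: "0 \<le> c" using p by (simp add: c_def)
  define L where "L = \<Lambda> 1 * (c + 2) * K + 1"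
  have near: "\<Lambda> q \<le> \<Lambda> s * (1 + c * y)"
    if qs: "1 \<le> q" "q \<le> s" "s \<le> b" and y: "y = K * (s - q)" "y \<le> 1 / 2" for q s y
  proof -
    have y0: "0 \<le> y" using K qs y by simp
    have "(1 - y) powr (- p) \<le> exp (2 * p * y)"
    proof -
      have "- y - 2 * y\<^sup>2 \<le> ln (1 - y)" by (rule ln_one_minus_pos_lower_bound[OF y0 y(2)])
      moreover have "y\<^sup>2 \<le> y * (1 / 2)" unfolding power2_eq_square using y0 y by (intro mult_left_mono) auto
      ultimately have "- 2 * y \<le> ln (1 - y)" by linarith
      then have "p * (- 2 * y) \<le> p * ln (1 - y)" using p by (rule mult_left_mono)
      then show ?thesis using y(2) by (simp add: powr_def mult_ac)
    qed
    also have "\<dots> \<le> 1 + 2 * p * y * exp (2 * p * y)"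
      using exp_ge_add_one_self[of "- (2 * p * y)"]
        mult_left_mono[of "1 - 2 * p * y" "exp (- (2 * p * y))" "exp (2 * p * y)"]
      by (simp add: exp_minus algebra_simps)
    also have "\<dots> \<le> 1 + 2 * p * y * exp p"
    proof -
      have "2 * p * y \<le> p" "0 \<le> 2 * p * y"
        using y(2) y0 p mult_left_mono[of "2 * y" 1 p] by (auto simp: mult_ac)
      then show ?thesis by (intro add_left_mono mult_left_mono) auto
    qed
    finally have bern: "(1 - y) powr (- p) \<le> 1 + c * y" by (simp add: c_def mult_ac)
    have factor: "0 < 1 + c * y" using c y0 by (simp add: add_pos_nonneg)
    have "\<Lambda> q \<le> \<Lambda> s * (1 + c * y) + \<epsilon>" if \<epsilon>: "0 < \<epsilon>" for \<epsilon>
    proof -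
      define \<eta> where "\<eta> = min 1 (\<epsilon> / (1 + c * y))"
      have \<eta>: "0 < \<eta>" "\<eta> \<le> 1" "\<eta> * (1 + c * y) \<le> \<epsilon>"
        using \<epsilon> factor by (simp_all add: \<eta>_def pos_le_divide_eq[symmetric])
      obtain u where u: "u \<in> U" "\<rho> s u < \<Lambda> s + \<eta>"
        using cINF_less_iff[OF U bdd, of s "\<Lambda> s + \<eta>"] \<eta>(1) by (auto simp: \<Lambda>_def)
      have "\<rho> s u \<le> \<Lambda> 1 + 1" using u(2) \<eta>(2) anti[of 1 s] qs by simp
      then have "D * \<rho> s u powr e * (s - q) \<le> y"
        unfolding y(1) K_def using D e qs nonneg[OF u(1)] by (intro mult_right_mono mult_left_mono powr_mono2) auto
      then have "\<rho> q u \<le> \<rho> s u * (1 - y) powr (- p)"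
        using growth[OF u(1) qs] y(2) by simp
      also have "\<dots> \<le> \<rho> s u * (1 + c * y)" using bern nonneg[OF u(1)] by (rule mult_left_mono)
      also have "\<dots> \<le> (\<Lambda> s + \<eta>) * (1 + c * y)" using u(2) factor by (intro mult_right_mono) auto
      also have "\<dots> \<le> \<Lambda> s * (1 + c * y) + \<epsilon>" using \<eta>(3) by (simp add: distrib_right)
      finally show ?thesis using lower[OF u(1), of q] by simp
    qed
    then show ?thesis by (rule field_le_epsilon)
  qed
  have main: "\<bar>\<Lambda> s - \<Lambda> q\<bar> \<le> L * (s - q)" if qs: "1 \<le> q" "q \<le> s" "s \<le> b" for q s
  proof -
    define y where "y = K * (s - q)"
    have y0: "0 \<le> y" using K qs by (simp add: y_def)
    have "\<Lambda> q - \<Lambda> s \<le> \<Lambda> 1 * (c + 2) * y"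
    proof (cases "y \<le> 1 / 2")
      case True
      have "\<Lambda> q - \<Lambda> s \<le> \<Lambda> s * (c * y)" using near[OF qs y_def True] by (simp add: distrib_left)
      also have "\<dots> \<le> \<Lambda> 1 * (c * y)" using anti[of 1 s] qs c y0 by (intro mult_right_mono) auto
      also have "\<dots> \<le> \<Lambda> 1 * ((c + 2) * y)" using \<Lambda>_nonneg y0 by (intro mult_left_mono mult_right_mono) auto
      finally show ?thesis by (simp add: mult.assoc)
    next
      case False
      have "\<Lambda> q - \<Lambda> s \<le> \<Lambda> 1 * 1" using anti[of 1 q] \<Lambda>_nonneg[of s] qs by simp
      also have "1 \<le> (c + 2) * y" unfolding distrib_right using False mult_nonneg_nonneg[OF c y0] by linarith
      then have "\<Lambda> 1 * 1 \<le> \<Lambda> 1 * ((c + 2) * y)" using \<Lambda>_nonneg by (intro mult_left_mono)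
      finally show ?thesis by (simp add: mult.assoc)
    qed
    also have "\<dots> \<le> L * (s - q)" using qs by (simp add: L_def y_def distrib_right mult.assoc)
    finally show ?thesis using anti[OF qs] by simp
  qed
  have "0 < L" using \<Lambda>_nonneg[of 1] c K by (simp add: L_def add_nonneg_pos)
  moreover have "\<bar>\<Lambda> s - \<Lambda> q\<bar> \<le> L * \<bar>s - q\<bar>" if "s \<in> {1..b}" "q \<in> {1..b}" for s q
    using main[of q s] main[of s q] that by (cases "q \<le> s") (auto simp: abs_minus_commute)
  ultimately show ?thesis unfolding \<Lambda>_def by blast
qed

lemma mult_cInf:
  fixes S :: "real set"
  assumes c: "0 < c" and S: "S \<noteq> {}" "bdd_below S"
  shows "c * Inf S = (INF x\<in>S. c * x)"
proof (rule antisym)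
  show "c * Inf S \<le> (INF x\<in>S. c * x)"
    using S c by (intro cINF_greatest mult_left_mono cInf_lower) auto
  obtain m where "\<And>x. x \<in> S \<Longrightarrow> m \<le> x" using S(2) by (auto simp: bdd_below_def)
  then have bdd: "bdd_below ((*) c ` S)"
    using c by (intro bdd_belowI[of _ "c * m"]) auto
  have "(INF x\<in>S. c * x) / c \<le> Inf S"
  proof (rule cInf_greatest[OF S(1)])
    fix x assume "x \<in> S"
    then have "(INF x\<in>S. c * x) \<le> c * x" by (rule cINF_lower[OF bdd])
    then show "(INF x\<in>S. c * x) / c \<le> x" using c by (simp add: field_simps)
  qed
  then show "(INF x\<in>S. c * x) \<le> c * Inf S" using c by (simp add: field_simps)
qed

theorem theorem9:
  fixes p :: real and \<Omega> :: "(real ^ 'n) set"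
  assumes "CARD('n) \<ge> 2"
    and "1 < p" and "p < real CARD('n)"
    and "bounded \<Omega>" and "smooth_domain \<Omega>"
  shows "\<forall>\<epsilon>>0. \<exists>L>0.
    \<forall>s\<in>{1..sobolev_conj CARD('n) p - \<epsilon>}. \<forall>q\<in>{1..sobolev_conj CARD('n) p - \<epsilon>}.
      \<bar>measure lebesgue \<Omega> powr (p / s) * sobolev_lambda p \<Omega> s
         - measure lebesgue \<Omega> powr (p / q) * sobolev_lambda p \<Omega> q\<bar> \<le> L * \<bar>s - q\<bar>"
proof (intro allI impI)
  fix \<epsilon> :: real assume \<epsilon>: "0 < \<epsilon>"
  note p = \<open>1 < p\<close>
  have \<Omega>: "open \<Omega>" "\<Omega> \<noteq> {}" using assms(5) by (auto simp: smooth_domain_def)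
  define b where "b = sobolev_conj CARD('n) p - \<epsilon>"
  \<comment> \<open>the Sobolev inequality requires \<open>r \<ge> p\<close>, also when all admissible exponents are smaller\<close>
  define r where "r = max p (b + \<epsilon> / 2)"
  have "p * (real CARD('n) - p) < real CARD('n) * p" using p by (simp add: algebra_simps)
  then have "p < sobolev_conj CARD('n) p"
    using assms(3) by (simp add: sobolev_conj_def field_simps)
  then have r: "p \<le> r" "r < sobolev_conj CARD('n) p" "b + \<epsilon> / 2 \<le> r"
    using \<epsilon> by (auto simp: r_def b_def)
  obtain C where C: "0 \<le> C" "\<And>u. u \<in> W1p_0 p \<Omega> \<Longrightarrow> (\<integral>\<^sup>+x. ennreal (\<bar>u x\<bar> powr r) \<partial>lebesgue_on \<Omega>)
      \<le> ennreal (C * (LINT x|lebesgue_on \<Omega>. norm (weak_gradient \<Omega> u x) powr p) powr (r / p))"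
    using W1p_0_subcritical_embedding[OF \<Omega>(1) assms(4) p, of r] assms(3) r by auto
  let ?M = "lebesgue_on \<Omega>"
  have lm: "\<Omega> \<in> lmeasurable" using \<Omega> assms(4) by (simp add: bounded_set_imp_lmeasurable)
  then have fin: "finite_measure ?M" by (rule finite_measure_lebesgue_on)
  define V where "V = measure lebesgue \<Omega>"
  have V: "measure ?M (space ?M) = V" "0 < V"
    using lm open_not_negligible[OF \<Omega>] by (auto simp: V_def measure_restrict_space negligible_iff_measure zero_less_measure_iff)
  define U where "U = {u \<in> W1p_0 p \<Omega>. \<not> (AE x in ?M. u x = 0)}"
  define E :: "(real ^ 'n \<Rightarrow> real) \<Rightarrow> real" where "E = (\<lambda>u. LINT x|?M. norm (weak_gradient \<Omega> u x) powr p)"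
  define I :: "real \<Rightarrow> (real ^ 'n \<Rightarrow> real) \<Rightarrow> real" where "I = (\<lambda>q u. LINT x|?M. \<bar>u x\<bar> powr q)"
  define \<rho> where "\<rho> = (\<lambda>q u. E u * (V / I q u) powr (p / q))"
  have E_nonneg: "0 \<le> E u" for u by (auto simp: E_def intro!: integral_nonneg_AE)
  have I_nonneg: "0 \<le> I q u" for q u by (auto simp: I_def intro!: integral_nonneg_AE)
  have U: "U \<noteq> {}" using ex_nonzero_W1p_0[OF \<Omega> p] by (auto simp: U_def)
  have eq: "V powr (p / q) * sobolev_lambda p \<Omega> q = (INF u\<in>U. \<rho> q u)" if "1 \<le> q" for q
  proof -
    have "V powr (p / q) * sobolev_lambda p \<Omega> q
        = V powr (p / q) * (INF u\<in>U. E u / I q u powr (p / q))"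
      using p by (simp add: sobolev_lambda_def Lp_norm_powr U_def E_def I_def image_Collect conj_commute Setcompr_eq_image)
    also have "\<dots> = (INF u\<in>U. V powr (p / q) * (E u / I q u powr (p / q)))"
      using V(2) U E_nonneg by (subst mult_cInf) (auto simp: image_image intro!: bdd_belowI[of _ 0])
    also have "\<dots> = (INF u\<in>U. \<rho> q u)"
      using V(2) I_nonneg by (intro INF_cong refl) (simp add: \<rho>_def powr_divide)
    finally show ?thesis .
  qed
  have u_props: "u \<in> borel_measurable ?M" "integrable ?M (\<lambda>x. \<bar>u x\<bar> powr r)"
    "I r u \<le> C * E u powr (r / p)" if u: "u \<in> U" for u
  proof -
    have W: "u \<in> W1p_0 p \<Omega>" using u by (simp add: U_def)
    show [measurable]: "u \<in> borel_measurable ?M" using W by (auto simp: W1p_0_def W1p_def Lp_space_def)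
    have fin: "(\<integral>\<^sup>+x. ennreal (\<bar>u x\<bar> powr r) \<partial>?M) \<le> ennreal (C * E u powr (r / p))"
      using C(2)[OF W] by (simp add: E_def)
    show int: "integrable ?M (\<lambda>x. \<bar>u x\<bar> powr r)"
      using fin by (intro integrableI_bounded) (auto intro: order.strict_trans1)
    have "ennreal (I r u) \<le> ennreal (C * E u powr (r / p))"
      using fin nn_integral_eq_integral[OF int] by (simp add: I_def)
    then show "I r u \<le> C * E u powr (r / p)" using C(1) by (subst (asm) ennreal_le_iff) auto
  qed
  have I_pos: "0 < I s u" if u: "u \<in> U" and s: "0 < s" "s \<le> r" for s u
  proof -
    note int = integrable_powr_less[OF fin u_props(1,2)[OF u] s]
    have "I s u \<noteq> 0"
    proof
      assume "I s u = 0"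
      then have "AE x in ?M. \<bar>u x\<bar> powr s = 0"
        unfolding I_def using integral_nonneg_eq_0_iff_AE[OF int] by simp
      then have "AE x in ?M. u x = 0" by eventually_elim simp
      then show False using u by (simp add: U_def)
    qed
    then show ?thesis using I_nonneg[of s u] by simp
  qed
  \<comment> \<open>\<open>X\<close> is the \<open>q\<close>-th power of the quotient of the normalised means of orders \<open>q\<close> and \<open>s\<close>\<close>
  have ratio: "\<exists>X>0. X \<le> 1 \<and> 1 - 2 * C / (V * \<epsilon>) * \<rho> s u powr (r / p) * (s - q) \<le> X
      \<and> \<rho> q u = \<rho> s u * X powr (- (p / q))"
    if u: "u \<in> U" and qs: "1 \<le> q" "q \<le> s" "s \<le> b" for q s u
  proof -
    have sr: "0 < q" "0 < s" "s < r" "\<epsilon> / 2 \<le> r - s" using qs r(3) \<epsilon> by auto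
    define a where "a = (I s u / V) powr (1 / s)"
    define X where "X = I q u / (V * a powr q)"
    have Is: "0 < I s u" "0 < I q u" using I_pos[OF u] sr qs by auto
    have a: "0 < a" using Is V by (simp add: a_def)
    have X: "0 < X" using a V(2) Is by (simp add: X_def)
    have cmp: "X \<le> 1" "1 - (s - q) / (r - s) * (I r u / (V * a powr r)) \<le> X"
      using power_integrals_compare[OF fin V u_props(1,2)[OF u] sr(1) qs(2) sr(3)
          a_def[unfolded I_def] Is(1)[unfolded I_def]] unfolding X_def I_def by auto
    have as: "I s u / V = a powr s" using Is V sr by (simp add: a_def powr_powr)
    then have "inverse (I s u / V) = inverse (a powr s)" by (rule arg_cong)
    then have "V / I s u = a powr (- s)" by (simp add: powr_minus inverse_eq_divide)
    then have \<rho>s: "\<rho> s u = E u * a powr (- p)" using sr by (simp add: \<rho>_def powr_powr)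
    have "V / I q u = X powr (- 1) * a powr (- q)"
      using X a V Is by (simp add: X_def powr_minus field_simps)
    then have "(V / I q u) powr (p / q) = X powr (- 1 * (p / q)) * a powr (- q * (p / q))"
      by (simp only: powr_mult powr_powr powr_ge_zero)
    then have "(V / I q u) powr (p / q) = X powr (- (p / q)) * a powr (- p)"
      using sr by simp
    then have \<rho>q: "\<rho> q u = \<rho> s u * X powr (- (p / q))"
      unfolding \<rho>s by (simp add: \<rho>_def)
    have "I r u / (V * a powr r) \<le> C * E u powr (r / p) / (V * a powr r)"
      using u_props(3)[OF u] V a by (intro divide_right_mono) auto
    also have "\<dots> = C / V * \<rho> s u powr (r / p)"
    proof -
      have "(E u * a powr (- p)) powr (r / p) = E u powr (r / p) * a powr (- p * (r / p))"
        by (simp only: powr_mult powr_powr)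
      also have "- p * (r / p) = - r" using p by simp
      finally show ?thesis by (simp add: \<rho>s powr_minus divide_inverse)
    qed
    finally have "(s - q) / (r - s) * (I r u / (V * a powr r)) \<le> (s - q) / (\<epsilon> / 2) * (C / V * \<rho> s u powr (r / p))"
      using sr qs \<epsilon> V(2) C(1) I_nonneg[of r u] by (intro mult_mono divide_left_mono) auto
    also have "\<dots> = 2 * C / (V * \<epsilon>) * \<rho> s u powr (r / p) * (s - q)" by (simp add: algebra_simps)
    finally have "1 - 2 * C / (V * \<epsilon>) * \<rho> s u powr (r / p) * (s - q) \<le> X" using cmp(2) by linarith
    then show ?thesis using X cmp(1) \<rho>q by blast
  qed
  have \<rho>_nonneg: "0 \<le> \<rho> q u" for q u using E_nonneg by (simp add: \<rho>_def)
  have "\<exists>L>0. \<forall>s\<in>{1..b}. \<forall>q\<in>{1..b}. \<bar>(INF u\<in>U. \<rho> s u) - (INF u\<in>U. \<rho> q u)\<bar> \<le> L * \<bar>s - q\<bar>"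
  proof (rule infima_lipschitz[OF U \<rho>_nonneg, where p = p and e = "r / p" and D = "2 * C / (V * \<epsilon>)"])
    show "0 \<le> p" "0 \<le> r / p" "0 \<le> 2 * C / (V * \<epsilon>)" using p r C(1) V(2) \<epsilon> by auto
    fix q s u assume u: "u \<in> U" and qs: "1 \<le> q" "q \<le> s" "s \<le> b"
    obtain X where X: "0 < X" "X \<le> 1" "1 - 2 * C / (V * \<epsilon>) * \<rho> s u powr (r / p) * (s - q) \<le> X"
      "\<rho> q u = \<rho> s u * X powr (- (p / q))" using ratio[OF u qs] by blast
    have "1 \<le> X powr (- (p / q))" using X p qs powr_mono'[of "- (p / q)" 0 X] by simp
    then show "\<rho> s u \<le> \<rho> q u" using mult_left_mono[OF _ \<rho>_nonneg] X(4) by fastforce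
    fix y assume y: "2 * C / (V * \<epsilon>) * \<rho> s u powr (r / p) * (s - q) \<le> y" "y < 1"
    have "0 \<le> 2 * C / (V * \<epsilon>) * \<rho> s u powr (r / p) * (s - q)" using C(1) V(2) \<epsilon> qs by simp
    then have y0: "0 \<le> y" using y by simp
    have "p / q \<le> p" using p qs by (simp add: field_simps)
    have "X powr (- (p / q)) \<le> (1 - y) powr (- (p / q))" using X(3) y p qs by (intro powr_mono2') auto
    also have "\<dots> \<le> (1 - y) powr (- p)" using y y0 \<open>p / q \<le> p\<close> by (intro powr_mono') auto
    finally show "\<rho> q u \<le> \<rho> s u * (1 - y) powr (- p)"
      unfolding X(4) by (rule mult_left_mono[OF _ \<rho>_nonneg])
  qed
  then show "\<exists>L>0. \<forall>s\<in>{1..sobolev_conj CARD('n) p - \<epsilon>}. \<forall>q\<in>{1..sobolev_conj CARD('n) p - \<epsilon>}.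
      \<bar>measure lebesgue \<Omega> powr (p / s) * sobolev_lambda p \<Omega> s
         - measure lebesgue \<Omega> powr (p / q) * sobolev_lambda p \<Omega> q\<bar> \<le> L * \<bar>s - q\<bar>"
    unfolding b_def[symmetric] V_def[symmetric] by (simp add: eq cong: ball_cong_simp)
qed

end
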